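(* Let $G$ and $H$ be topological groups satisfying one of the following two conditions: (i) the torsion part of $G$ is dense in $G$ and the completion $\hat{H}$ is torsion-free; (ii) there exists $n\in\mathbb{N}$ such that $\hat{G}^{(n)}=\hat{G}$ and $H^{(n)}=\{e\}$. If two $G^{\star\star}$-regular spaces $X$ and $Y$ are $(G\times H)$-equivalent, then they are both $G$-equivalent and $H$-equivalent.
   Context: All spaces are Tychonoff and non-empty; all topological groups are Hausdorff; $e$ denotes the identity. $\hat{K}$ denotes the completion of a topological group $K$ with respect to the two-sided uniformity. The torsion part of a group $K$ is the set of $g\in K$ with $g^m=e$ for some $m\ge1$; $K$ is torsion-free if its torsion part is $\{e\}$. For $n\in\mathbb{N}$, $K^{(n)}=\{g^n:g\in K\}$. $C_p(X,K)$ is the group of continuous maps $X\to K$ with pointwise operations and topology of pointwise convergence; $X,Y$ are $K$-equivalent if $C_p(X,K)\cong C_p(Y,K)$ as topological groups. $X$ is $G^{\star\star}$-regular if for every closed $F\subseteq X$, every $x\in X\setminus F$ and every $g\in G$ there is $f\in C_p(X,G)$ with $f(x)=g$ and $f(F)\subseteq\{e\}$. *)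

theory Defs
  imports "HOL-Analysis.Analysis" "HOL-Algebra.Group"
begin

definition topological_group :: "('g, 'm) monoid_scheme \<Rightarrow> 'g topology \<Rightarrow> bool" where
  "topological_group G T \<longleftrightarrow>
     group G \<and> topspace T = carrier G \<and> Hausdorff_space T \<and>
     continuous_map (prod_topology T T) T (\<lambda>(x, y). x \<otimes>\<^bsub>G\<^esub> y) \<and>
     continuous_map T T (\<lambda>x. inv\<^bsub>G\<^esub> x)"

definition top_group_isomorphic ::
  "('a, 'm) monoid_scheme \<Rightarrow> 'a topology \<Rightarrow> ('b, 'n) monoid_scheme \<Rightarrow> 'b topology \<Rightarrow> bool" where
  "top_group_isomorphic G1 T1 G2 T2 \<longleftrightarrow> (\<exists>\<phi>. \<phi> \<in> iso G1 G2 \<and> homeomorphic_map T1 T2 \<phi>)"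

definition torsion_part :: "('g, 'm) monoid_scheme \<Rightarrow> 'g set" where
  "torsion_part G = {g \<in> carrier G. \<exists>m::nat. m \<ge> 1 \<and> g [^]\<^bsub>G\<^esub> m = \<one>\<^bsub>G\<^esub>}"

definition torsion_free :: "('g, 'm) monoid_scheme \<Rightarrow> bool" where
  "torsion_free G \<longleftrightarrow> torsion_part G = {\<one>\<^bsub>G\<^esub>}"

definition power_set_grp :: "('g, 'm) monoid_scheme \<Rightarrow> nat \<Rightarrow> 'g set" where
  "power_set_grp G n = {g [^]\<^bsub>G\<^esub> n | g. g \<in> carrier G}"

definition two_sided_close :: "('g, 'm) monoid_scheme \<Rightarrow> 'g topology \<Rightarrow> 'g filter \<Rightarrow> 'g filter \<Rightarrow> bool" where
  "two_sided_close G T F1 F2 \<longleftrightarrow>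
     (\<forall>U. openin T U \<and> \<one>\<^bsub>G\<^esub> \<in> U \<longrightarrow>
        eventually (\<lambda>(x, y). inv\<^bsub>G\<^esub> x \<otimes>\<^bsub>G\<^esub> y \<in> U \<and> y \<otimes>\<^bsub>G\<^esub> inv\<^bsub>G\<^esub> x \<in> U) (F1 \<times>\<^sub>F F2))"

definition cauchy_filter_grp :: "('g, 'm) monoid_scheme \<Rightarrow> 'g topology \<Rightarrow> 'g filter \<Rightarrow> bool" where
  "cauchy_filter_grp G T F \<longleftrightarrow>
     F \<noteq> bot \<and> eventually (\<lambda>x. x \<in> carrier G) F \<and> two_sided_close G T F F"

definition cauchy_class :: "('g, 'm) monoid_scheme \<Rightarrow> 'g topology \<Rightarrow> 'g filter \<Rightarrow> 'g filter set" where
  "cauchy_class G T F = {F'. cauchy_filter_grp G T F' \<and> two_sided_close G T F F'}"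

text \<open>The (Raikov) completion as an abstract group; operations are the continuous
  extensions, computed on representatives.\<close>
definition completion_grp :: "('g, 'm) monoid_scheme \<Rightarrow> 'g topology \<Rightarrow> ('g filter set) monoid" where
  "completion_grp G T =
     \<lparr> carrier = {cauchy_class G T F | F. cauchy_filter_grp G T F},
       mult = (\<lambda>A B. cauchy_class G T
                 (filtermap (\<lambda>(x, y). x \<otimes>\<^bsub>G\<^esub> y) ((SOME F. F \<in> A) \<times>\<^sub>F (SOME F. F \<in> B)))),
       one = cauchy_class G T (principal {\<one>\<^bsub>G\<^esub>}) \<rparr>"

definition Cp_grp :: "'x topology \<Rightarrow> ('g, 'm) monoid_scheme \<Rightarrow> 'g topology \<Rightarrow> ('x \<Rightarrow> 'g) monoid" where
  "Cp_grp X K T =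
     \<lparr> carrier = {f. continuous_map X T f \<and> f \<in> extensional (topspace X)},
       mult = (\<lambda>f g. \<lambda>x\<in>topspace X. f x \<otimes>\<^bsub>K\<^esub> g x),
       one = (\<lambda>x\<in>topspace X. \<one>\<^bsub>K\<^esub>) \<rparr>"

definition Cp_top :: "'x topology \<Rightarrow> ('g, 'm) monoid_scheme \<Rightarrow> 'g topology \<Rightarrow> ('x \<Rightarrow> 'g) topology" where
  "Cp_top X K T = subtopology (product_topology (\<lambda>_. T) (topspace X)) (carrier (Cp_grp X K T))"

definition K_equivalent ::
  "('g, 'm) monoid_scheme \<Rightarrow> 'g topology \<Rightarrow> 'x topology \<Rightarrow> 'y topology \<Rightarrow> bool" where
  "K_equivalent K T X Y \<longleftrightarrow> top_group_isomorphic (Cp_grp X K T) (Cp_top X K T) (Cp_grp Y K T) (Cp_top Y K T)"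

definition tychonoff_space :: "'x topology \<Rightarrow> bool" where
  "tychonoff_space X \<longleftrightarrow> completely_regular_space X \<and> Hausdorff_space X \<and> topspace X \<noteq> {}"

definition Gss_regular :: "'x topology \<Rightarrow> ('g, 'm) monoid_scheme \<Rightarrow> 'g topology \<Rightarrow> bool" where
  "Gss_regular X G T \<longleftrightarrow>
     (\<forall>F x g. closedin X F \<and> x \<in> topspace X - F \<and> g \<in> carrier G \<longrightarrow>
        (\<exists>f. continuous_map X T f \<and> f x = g \<and> f ` F \<subseteq> {\<one>\<^bsub>G\<^esub>}))"

end

theory Submission
  imports Defs
begin

text \<open>
  By \<open>G\<^sup>\<star>\<^sup>\<star>\<close>-regularity \<open>C\<^sub>p(X,G)\<close> is dense in \<open>G\<^sup>X\<close>. Under (i) the torsion elements of \<open>G\<^sup>X\<close> are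
  dense, and a continuous homomorphism \<open>C\<^sub>p(X,G) \<rightarrow> H\<close> extends to them with torsion values in the
  torsion-free completion of \<open>H\<close>; under (ii) the \<open>n\<close>-th powers are dense in \<open>C\<^sub>p(X,G)\<close> and have
  trivial images. Either way all such homomorphisms, hence all continuous homomorphisms
  \<open>C\<^sub>p(X,G) \<rightarrow> C\<^sub>p(Y,H)\<close>, are trivial. Since \<open>C\<^sub>p(X,G \<times> H) = C\<^sub>p(X,G) \<times> C\<^sub>p(X,H)\<close>, an isomorphism
  for \<open>G \<times> H\<close> maps the factor \<open>C\<^sub>p(X,G)\<close> onto \<open>C\<^sub>p(Y,G)\<close>, and it induces an isomorphism of the
  quotients \<open>C\<^sub>p(X,H)\<close> and \<open>C\<^sub>p(Y,H)\<close>.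
\<close>

section \<open>Topological groups and Cauchy filters\<close>

text \<open>The detour through the full power \<open>G^X\<close> is forced. For the circle
  \<open>G\<close> and \<open>X = [0,1]\<close> the torsion part of \<open>G\<close> is dense, yet
  the torsion elements of \<open>C_p(X,G)\<close> are only constant functions. In \<open>G^X\<close>
  torsion elements are dense, but there the homomorphism is undefined, so a torsion point
  \<open>t\<close> can be approached only through elements of \<open>C_p(X,G)\<close> near it. Their
  images form a Cauchy filter in \<open>H\<close>, and its class is the value that an extension
  would take at \<open>t\<close>. Hence the completion enters purely as a set of classes of Cauchy
  filters, and the computation needed in it is the power of a class.

  Homomorphisms vanish in one direction only; those from the \<open>H\<close> side to the
  \<open>G\<close> side may be nontrivial. An isomorphism of the function groups is therefore
  triangular rather than diagonal. This is why the \<open>G\<close> factor is recovered as a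
  subgroup and the \<open>H\<close> factor as a quotient, and why triangularity is established for
  the inverse as well.\<close>

context
  fixes G :: "('g, 'm) monoid_scheme" and T :: "'g topology"
  assumes tg: "topological_group G T"
begin

lemma topological_group_group: "group G"
  and topological_group_topspace: "topspace T = carrier G"
  and topological_group_Hausdorff: "Hausdorff_space T"
  using tg by (auto simp: topological_group_def)

interpretation group G by (rule topological_group_group)

lemma topological_group_continuous_mult:
  assumes "continuous_map X T f" "continuous_map X T g"
  shows "continuous_map X T (\<lambda>x. f x \<otimes>\<^bsub>G\<^esub> g x)"
proof -
  have "continuous_map X (prod_topology T T) (\<lambda>x. (f x, g x))"
    using assms by (simp add: continuous_map_pairedI)
  moreover have "continuous_map (prod_topology T T) T (\<lambda>(x, y). x \<otimes>\<^bsub>G\<^esub> y)"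
    using tg by (simp add: topological_group_def)
  ultimately show ?thesis
    using continuous_map_compose by (fastforce simp: o_def)
qed

lemma topological_group_continuous_inv:
  assumes "continuous_map X T f"
  shows "continuous_map X T (\<lambda>x. inv\<^bsub>G\<^esub> (f x))"
  using continuous_map_compose[OF assms, of T "\<lambda>x. inv\<^bsub>G\<^esub> x"] tg
  by (simp add: topological_group_def o_def)

lemma topological_group_continuous_const:
  "a \<in> carrier G \<Longrightarrow> continuous_map X T (\<lambda>x. a)"
  using topological_group_topspace by (simp add: continuous_map_const)

lemma topological_group_continuous_pow:
  assumes "continuous_map X T f"
  shows "continuous_map X T (\<lambda>x. f x [^]\<^bsub>G\<^esub> (n::nat))"
  by (induction n) (simp_all add: topological_group_continuous_mult assms topological_group_topspace)

lemma topological_group_small: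
  assumes "openin T U" "\<one>\<^bsub>G\<^esub> \<in> U"
  obtains V where "openin T V" "\<one>\<^bsub>G\<^esub> \<in> V"
    "\<And>x y. x \<in> V \<Longrightarrow> y \<in> V \<Longrightarrow> x \<otimes>\<^bsub>G\<^esub> y \<in> U" "\<And>x. x \<in> V \<Longrightarrow> inv\<^bsub>G\<^esub> x \<in> V"
proof -
  have "openin (prod_topology T T) {z \<in> topspace (prod_topology T T). (\<lambda>(x, y). x \<otimes>\<^bsub>G\<^esub> y) z \<in> U}"
    using tg assms by (intro openin_continuous_map_preimage) (auto simp: topological_group_def)
  then obtain A B where AB: "openin T A" "openin T B" "\<one>\<^bsub>G\<^esub> \<in> A" "\<one>\<^bsub>G\<^esub> \<in> B"
    "A \<times> B \<subseteq> {z \<in> topspace (prod_topology T T). (\<lambda>(x, y). x \<otimes>\<^bsub>G\<^esub> y) z \<in> U}"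
    using assms unfolding openin_prod_topology_alt
    by (elim allE[of _ "\<one>\<^bsub>G\<^esub>"]) (auto simp: topological_group_topspace)
  define W where "W = A \<inter> B"
  define V where "V = W \<inter> {x \<in> topspace T. inv\<^bsub>G\<^esub> x \<in> W}"
  have W: "openin T W" "\<one>\<^bsub>G\<^esub> \<in> W" using AB by (auto simp: W_def)
  have sub: "W \<subseteq> carrier G" using openin_subset[OF W(1)] topological_group_topspace by simp
  show ?thesis
  proof
    have "continuous_map T T (\<lambda>x. inv\<^bsub>G\<^esub> x)" using tg by (simp add: topological_group_def)
    then show "openin T V"
      unfolding V_def using W by (intro openin_Int openin_continuous_map_preimage) auto
    show "\<one>\<^bsub>G\<^esub> \<in> V" using W by (simp add: V_def topological_group_topspace)
    show "x \<otimes>\<^bsub>G\<^esub> y \<in> U" if "x \<in> V" "y \<in> V" for x y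
      using that AB(5) by (auto simp: V_def W_def)
    show "inv\<^bsub>G\<^esub> x \<in> V" if "x \<in> V" for x
      using that sub by (auto simp: V_def topological_group_topspace)
  qed
qed

lemma topological_group_small3:
  assumes "openin T U" "\<one>\<^bsub>G\<^esub> \<in> U"
  obtains V where "openin T V" "\<one>\<^bsub>G\<^esub> \<in> V"
    "\<And>x y z. x \<in> V \<Longrightarrow> y \<in> V \<Longrightarrow> z \<in> V \<Longrightarrow> x \<otimes>\<^bsub>G\<^esub> y \<otimes>\<^bsub>G\<^esub> z \<in> U"
proof -
  obtain V1 where V1: "openin T V1" "\<one>\<^bsub>G\<^esub> \<in> V1"
    "\<And>x y. x \<in> V1 \<Longrightarrow> y \<in> V1 \<Longrightarrow> x \<otimes>\<^bsub>G\<^esub> y \<in> U" using topological_group_small[OF assms] by metis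
  obtain V where V: "openin T V" "\<one>\<^bsub>G\<^esub> \<in> V"
    "\<And>x y. x \<in> V \<Longrightarrow> y \<in> V \<Longrightarrow> x \<otimes>\<^bsub>G\<^esub> y \<in> V1" using topological_group_small[OF V1(1,2)] by metis
  show ?thesis
  proof (rule that[of "V \<inter> V1"])
    show "openin T (V \<inter> V1)" "\<one>\<^bsub>G\<^esub> \<in> V \<inter> V1" using V V1 by auto
    show "x \<otimes>\<^bsub>G\<^esub> y \<otimes>\<^bsub>G\<^esub> z \<in> U" if "x \<in> V \<inter> V1" "y \<in> V \<inter> V1" "z \<in> V \<inter> V1" for x y z
      using that V V1 by auto
  qed
qed

lemma topological_group_separate:
  assumes "a \<in> carrier G" "\<And>U. openin T U \<Longrightarrow> \<one>\<^bsub>G\<^esub> \<in> U \<Longrightarrow> a \<in> U"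
  shows "a = \<one>\<^bsub>G\<^esub>"
proof (rule ccontr)
  assume "a \<noteq> \<one>\<^bsub>G\<^esub>"
  then obtain U V where "openin T U" "openin T V" "\<one>\<^bsub>G\<^esub> \<in> U" "a \<in> V" "disjnt U V"
    using topological_group_Hausdorff assms(1) one_closed unfolding Hausdorff_space_def topological_group_topspace
    by metis
  then show False using assms(2)[of U] by (auto simp: disjnt_iff)
qed

section \<open>Closeness as an equivalence relation on Cauchy filters\<close>

lemma two_sided_closeD:
  assumes "two_sided_close G T F F'" "openin T U" "\<one>\<^bsub>G\<^esub> \<in> U"
  obtains P Q where "eventually P F" "eventually Q F'"
    "\<And>x y. P x \<Longrightarrow> Q y \<Longrightarrow> inv\<^bsub>G\<^esub> x \<otimes>\<^bsub>G\<^esub> y \<in> U \<and> y \<otimes>\<^bsub>G\<^esub> inv\<^bsub>G\<^esub> x \<in> U"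
proof -
  have "eventually (\<lambda>(x, y). inv\<^bsub>G\<^esub> x \<otimes>\<^bsub>G\<^esub> y \<in> U \<and> y \<otimes>\<^bsub>G\<^esub> inv\<^bsub>G\<^esub> x \<in> U) (F \<times>\<^sub>F F')"
    using assms by (auto simp: two_sided_close_def)
  then show ?thesis using that unfolding eventually_prod_filter by (metis (no_types, lifting) case_prod_conv)
qed

text \<open>Exchanging the filters turns \<open>x^-1 y\<close> into its inverse, so the estimate is
  made in a neighbourhood closed under inversion.\<close>

lemma two_sided_close_sym:
  assumes "two_sided_close G T F F'" "eventually (\<lambda>x. x \<in> carrier G) F" "eventually (\<lambda>x. x \<in> carrier G) F'"
  shows "two_sided_close G T F' F"
  unfolding two_sided_close_def
proof (intro allI impI, elim conjE)
  fix U assume "openin T U" "\<one>\<^bsub>G\<^esub> \<in> U"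
  then obtain V where V: "openin T V" "\<one>\<^bsub>G\<^esub> \<in> V" "\<And>x y. x \<in> V \<Longrightarrow> y \<in> V \<Longrightarrow> x \<otimes>\<^bsub>G\<^esub> y \<in> U"
    "\<And>x. x \<in> V \<Longrightarrow> inv\<^bsub>G\<^esub> x \<in> V" by (rule topological_group_small) blast
  have VU: "x \<in> U" if "x \<in> V" for x
    using V(3)[OF that V(2)] openin_subset[OF V(1)] that by (auto simp: topological_group_topspace)
  obtain P Q where PQ: "eventually P F" "eventually Q F'"
    "\<And>x y. P x \<Longrightarrow> Q y \<Longrightarrow> inv\<^bsub>G\<^esub> x \<otimes>\<^bsub>G\<^esub> y \<in> V \<and> y \<otimes>\<^bsub>G\<^esub> inv\<^bsub>G\<^esub> x \<in> V"
    using two_sided_closeD[OF assms(1) V(1,2)] by blast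
  show "eventually (\<lambda>(x, y). inv\<^bsub>G\<^esub> x \<otimes>\<^bsub>G\<^esub> y \<in> U \<and> y \<otimes>\<^bsub>G\<^esub> inv\<^bsub>G\<^esub> x \<in> U) (F' \<times>\<^sub>F F)"
    unfolding eventually_prod_filter
  proof (intro exI conjI allI impI)
    show "eventually (\<lambda>x. Q x \<and> x \<in> carrier G) F'" "eventually (\<lambda>x. P x \<and> x \<in> carrier G) F"
      using PQ assms by (auto intro: eventually_conj)
    fix x y assume *: "Q x \<and> x \<in> carrier G" "P y \<and> y \<in> carrier G"
    then have "inv\<^bsub>G\<^esub> (inv\<^bsub>G\<^esub> y \<otimes>\<^bsub>G\<^esub> x) \<in> U" "inv\<^bsub>G\<^esub> (x \<otimes>\<^bsub>G\<^esub> inv\<^bsub>G\<^esub> y) \<in> U"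
      using PQ(3)[of y x] VU V(4) by auto
    then show "case (x, y) of (x, y) \<Rightarrow> inv\<^bsub>G\<^esub> x \<otimes>\<^bsub>G\<^esub> y \<in> U \<and> y \<otimes>\<^bsub>G\<^esub> inv\<^bsub>G\<^esub> x \<in> U"
      using * by (simp add: inv_mult_group)
  qed
qed

text \<open>Both estimates meet in one point \<open>z\<close> of the middle filter, which exists
  because \<open>F2\<close> is proper; then \<open>x^-1 y = (x^-1 z)(z^-1 y)\<close>, and similarly
  for \<open>y x^-1\<close>.\<close>

lemma two_sided_close_trans:
  assumes "two_sided_close G T F1 F2" "two_sided_close G T F2 F3"
    and "cauchy_filter_grp G T F1" "cauchy_filter_grp G T F2" "cauchy_filter_grp G T F3"
  shows "two_sided_close G T F1 F3"
  unfolding two_sided_close_def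
proof (intro allI impI, elim conjE)
  fix U assume "openin T U" "\<one>\<^bsub>G\<^esub> \<in> U"
  then obtain V where V: "openin T V" "\<one>\<^bsub>G\<^esub> \<in> V" "\<And>x y. x \<in> V \<Longrightarrow> y \<in> V \<Longrightarrow> x \<otimes>\<^bsub>G\<^esub> y \<in> U"
    by (rule topological_group_small) blast
  obtain P Q where PQ: "eventually P F1" "eventually Q F2"
    "\<And>x y. P x \<Longrightarrow> Q y \<Longrightarrow> inv\<^bsub>G\<^esub> x \<otimes>\<^bsub>G\<^esub> y \<in> V \<and> y \<otimes>\<^bsub>G\<^esub> inv\<^bsub>G\<^esub> x \<in> V"
    using two_sided_closeD[OF assms(1) V(1,2)] by blast
  obtain R S where RS: "eventually R F2" "eventually S F3"
    "\<And>x y. R x \<Longrightarrow> S y \<Longrightarrow> inv\<^bsub>G\<^esub> x \<otimes>\<^bsub>G\<^esub> y \<in> V \<and> y \<otimes>\<^bsub>G\<^esub> inv\<^bsub>G\<^esub> x \<in> V"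
    using two_sided_closeD[OF assms(2) V(1,2)] by blast
  have "eventually (\<lambda>z. Q z \<and> R z \<and> z \<in> carrier G) F2" "F2 \<noteq> bot"
    using PQ RS assms by (auto intro!: eventually_conj simp: cauchy_filter_grp_def)
  then obtain z where z: "Q z" "R z" "z \<in> carrier G"
    using eventually_happens' by blast
  show "eventually (\<lambda>(x, y). inv\<^bsub>G\<^esub> x \<otimes>\<^bsub>G\<^esub> y \<in> U \<and> y \<otimes>\<^bsub>G\<^esub> inv\<^bsub>G\<^esub> x \<in> U) (F1 \<times>\<^sub>F F3)"
    unfolding eventually_prod_filter
  proof (intro exI conjI allI impI)
    show "eventually (\<lambda>x. P x \<and> x \<in> carrier G) F1" "eventually (\<lambda>x. S x \<and> x \<in> carrier G) F3"
      using PQ RS assms by (auto intro: eventually_conj simp: cauchy_filter_grp_def)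
    fix x y assume *: "P x \<and> x \<in> carrier G" "S y \<and> y \<in> carrier G"
    have "(inv\<^bsub>G\<^esub> x \<otimes>\<^bsub>G\<^esub> z) \<otimes>\<^bsub>G\<^esub> (inv\<^bsub>G\<^esub> z \<otimes>\<^bsub>G\<^esub> y) \<in> U" "(y \<otimes>\<^bsub>G\<^esub> inv\<^bsub>G\<^esub> z) \<otimes>\<^bsub>G\<^esub> (z \<otimes>\<^bsub>G\<^esub> inv\<^bsub>G\<^esub> x) \<in> U"
      using * z PQ(3) RS(3) V(3) by auto
    then show "case (x, y) of (x, y) \<Rightarrow> inv\<^bsub>G\<^esub> x \<otimes>\<^bsub>G\<^esub> y \<in> U \<and> y \<otimes>\<^bsub>G\<^esub> inv\<^bsub>G\<^esub> x \<in> U"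
      using * z by (simp add: m_assoc inv_solve_left' flip: m_assoc[of z] m_assoc[of "inv\<^bsub>G\<^esub> z"])
  qed
qed

text \<open>Through this equivalence an equation between points of the completion becomes an
  estimate inside \<open>G\<close>; both hypotheses on completions are exploited in this
  way.\<close>

lemma cauchy_class_eq_iff:
  assumes "cauchy_filter_grp G T F" "cauchy_filter_grp G T F'"
  shows "cauchy_class G T F = cauchy_class G T F' \<longleftrightarrow> two_sided_close G T F F'"
proof
  assume "cauchy_class G T F = cauchy_class G T F'"
  moreover have "F' \<in> cauchy_class G T F'" using assms by (auto simp: cauchy_class_def cauchy_filter_grp_def)
  ultimately show "two_sided_close G T F F'" by (auto simp: cauchy_class_def)
next
  assume c: "two_sided_close G T F F'"
  have c': "two_sided_close G T F' F"
    by (rule two_sided_close_sym) (use c assms in \<open>simp_all add: cauchy_filter_grp_def\<close>)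
  have "two_sided_close G T F K \<longleftrightarrow> two_sided_close G T F' K" if "cauchy_filter_grp G T K" for K
    using two_sided_close_trans[OF c _ assms that] two_sided_close_trans[OF c' _ assms(2,1) that] by metis
  then show "cauchy_class G T F = cauchy_class G T F'"
    unfolding cauchy_class_def by (intro Collect_cong conj_cong refl)
qed

text \<open>Serves two passages to a finer filter: from a product of filters to its diagonal, when
  powers are computed, and from a neighbourhood filter to its trace on a dense subgroup.\<close>

lemma two_sided_close_finer:
  assumes "F' \<le> F" "two_sided_close G T F F"
  shows "two_sided_close G T F F'" "two_sided_close G T F' F'"
  using assms unfolding two_sided_close_def
  by (auto intro: filter_leD[OF prod_filter_mono])

text \<open>Conjugation need not be uniformly continuous, so the cross terms are conjugated by points
  \<open>x0\<close> and \<open>y0\<close> that stay fixed while the filters get small.\<close>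

lemma two_sided_close_mult:
  assumes "two_sided_close G T F1 F1'" "two_sided_close G T F2 F2'"
    and "cauchy_filter_grp G T F1" "cauchy_filter_grp G T F2"
    and "cauchy_filter_grp G T F1'" "cauchy_filter_grp G T F2'"
  shows "two_sided_close G T (filtermap (\<lambda>(x, y). x \<otimes>\<^bsub>G\<^esub> y) (F1 \<times>\<^sub>F F2))
           (filtermap (\<lambda>(x, y). x \<otimes>\<^bsub>G\<^esub> y) (F1' \<times>\<^sub>F F2'))"
  unfolding two_sided_close_def
proof (intro allI impI, elim conjE)
  fix U assume "openin T U" "\<one>\<^bsub>G\<^esub> \<in> U"
  then obtain V where V: "openin T V" "\<one>\<^bsub>G\<^esub> \<in> V"
    "\<And>x y z. x \<in> V \<Longrightarrow> y \<in> V \<Longrightarrow> z \<in> V \<Longrightarrow> x \<otimes>\<^bsub>G\<^esub> y \<otimes>\<^bsub>G\<^esub> z \<in> U"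
    by (rule topological_group_small3) blast
  \<comment> \<open>A single reference point \<open>z\<close>, taken from \<open>F'\<close>, is
    eventually within \<open>V\<close> of both filters: of \<open>F\<close> by closeness, of
    \<open>F'\<close> because \<open>F'\<close> is Cauchy.\<close>
  have middle: "\<exists>z. z \<in> carrier G \<and> (\<exists>P Q. eventually P F \<and> eventually Q F' \<and>
      (\<forall>x. P x \<longrightarrow> inv\<^bsub>G\<^esub> x \<otimes>\<^bsub>G\<^esub> z \<in> V \<and> z \<otimes>\<^bsub>G\<^esub> inv\<^bsub>G\<^esub> x \<in> V) \<and>
      (\<forall>y. Q y \<longrightarrow> inv\<^bsub>G\<^esub> z \<otimes>\<^bsub>G\<^esub> y \<in> V \<and> y \<otimes>\<^bsub>G\<^esub> inv\<^bsub>G\<^esub> z \<in> V))"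
    if FF: "two_sided_close G T F F'" and F': "cauchy_filter_grp G T F'" for F F'
  proof -
    obtain P Q where PQ: "eventually P F" "eventually Q F'"
      "\<And>x y. P x \<Longrightarrow> Q y \<Longrightarrow> inv\<^bsub>G\<^esub> x \<otimes>\<^bsub>G\<^esub> y \<in> V \<and> y \<otimes>\<^bsub>G\<^esub> inv\<^bsub>G\<^esub> x \<in> V"
      using two_sided_closeD[OF FF V(1,2)] by blast
    have "two_sided_close G T F' F'" using F' by (simp add: cauchy_filter_grp_def)
    then obtain R S where RS: "eventually R F'" "eventually S F'"
      "\<And>x y. R x \<Longrightarrow> S y \<Longrightarrow> inv\<^bsub>G\<^esub> x \<otimes>\<^bsub>G\<^esub> y \<in> V \<and> y \<otimes>\<^bsub>G\<^esub> inv\<^bsub>G\<^esub> x \<in> V"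
      using two_sided_closeD[OF _ V(1,2)] by blast
    have "eventually (\<lambda>z. Q z \<and> R z \<and> z \<in> carrier G) F'" "F' \<noteq> bot"
      using PQ RS F' by (auto intro!: eventually_conj simp: cauchy_filter_grp_def)
    then obtain z where "Q z" "R z" "z \<in> carrier G"
      using eventually_happens' by blast
    with PQ RS show ?thesis by blast
  qed
  obtain x0 P1 Q1 where 1: "x0 \<in> carrier G" "eventually P1 F1" "eventually Q1 F1'"
    "\<And>x. P1 x \<Longrightarrow> x0 \<otimes>\<^bsub>G\<^esub> inv\<^bsub>G\<^esub> x \<in> V" "\<And>x. Q1 x \<Longrightarrow> x \<otimes>\<^bsub>G\<^esub> inv\<^bsub>G\<^esub> x0 \<in> V"
    using middle[OF assms(1,5)] by blast
  obtain y0 P2 Q2 where 2: "y0 \<in> carrier G" "eventually P2 F2" "eventually Q2 F2'"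
    "\<And>x. P2 x \<Longrightarrow> inv\<^bsub>G\<^esub> x \<otimes>\<^bsub>G\<^esub> y0 \<in> V" "\<And>x. Q2 x \<Longrightarrow> inv\<^bsub>G\<^esub> y0 \<otimes>\<^bsub>G\<^esub> x \<in> V"
    using middle[OF assms(2,6)] by blast
  \<comment> \<open>For fixed \<open>a\<close> conjugation is continuous, so \<open>N a\<close> is a
    neighbourhood of one whose elements stay in \<open>V\<close> after conjugation.\<close>
  define N where "N a = {u \<in> carrier G. inv\<^bsub>G\<^esub> a \<otimes>\<^bsub>G\<^esub> u \<otimes>\<^bsub>G\<^esub> a \<in> V}" for a
  have N: "openin T (N a)" "\<one>\<^bsub>G\<^esub> \<in> N a" if "a \<in> carrier G" for a
  proof -
    have "continuous_map T T (\<lambda>u. inv\<^bsub>G\<^esub> a \<otimes>\<^bsub>G\<^esub> u \<otimes>\<^bsub>G\<^esub> a)"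
      using that by (intro topological_group_continuous_mult topological_group_continuous_const) auto
    from openin_continuous_map_preimage[OF this V(1)] show "openin T (N a)"
      by (simp add: topological_group_topspace N_def)
    show "\<one>\<^bsub>G\<^esub> \<in> N a" using that V(2) by (simp add: N_def)
  qed
  obtain P3 Q3 where 3: "eventually P3 F1" "eventually Q3 F1'"
    "\<And>x y. P3 x \<Longrightarrow> Q3 y \<Longrightarrow> inv\<^bsub>G\<^esub> x \<otimes>\<^bsub>G\<^esub> y \<in> N y0 \<and> y \<otimes>\<^bsub>G\<^esub> inv\<^bsub>G\<^esub> x \<in> N y0"
    using two_sided_closeD[OF assms(1) N[OF 2(1)]] by blast
  have x0': "inv\<^bsub>G\<^esub> x0 \<in> carrier G" using 1(1) by simp
  obtain P4 Q4 where 4: "eventually P4 F2" "eventually Q4 F2'"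
    "\<And>x y. P4 x \<Longrightarrow> Q4 y \<Longrightarrow> inv\<^bsub>G\<^esub> x \<otimes>\<^bsub>G\<^esub> y \<in> N (inv\<^bsub>G\<^esub> x0) \<and> y \<otimes>\<^bsub>G\<^esub> inv\<^bsub>G\<^esub> x \<in> N (inv\<^bsub>G\<^esub> x0)"
    using two_sided_closeD[OF assms(2) N[OF x0']] by blast
  define A where "A = (\<lambda>z. \<exists>x y. z = x \<otimes>\<^bsub>G\<^esub> y \<and> (P1 x \<and> P3 x \<and> x \<in> carrier G) \<and> (P2 y \<and> P4 y \<and> y \<in> carrier G))"
  define B where "B = (\<lambda>z. \<exists>x y. z = x \<otimes>\<^bsub>G\<^esub> y \<and> (Q1 x \<and> Q3 x \<and> x \<in> carrier G) \<and> (Q2 y \<and> Q4 y \<and> y \<in> carrier G))"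
  show "eventually (\<lambda>(x, y). inv\<^bsub>G\<^esub> x \<otimes>\<^bsub>G\<^esub> y \<in> U \<and> y \<otimes>\<^bsub>G\<^esub> inv\<^bsub>G\<^esub> x \<in> U)
     (filtermap (\<lambda>(x, y). x \<otimes>\<^bsub>G\<^esub> y) (F1 \<times>\<^sub>F F2) \<times>\<^sub>F filtermap (\<lambda>(x, y). x \<otimes>\<^bsub>G\<^esub> y) (F1' \<times>\<^sub>F F2'))"
    unfolding eventually_prod_filter[of _ "filtermap _ _"]
  proof (rule exI[of _ A], rule exI[of _ B], intro conjI allI impI)
    have "eventually (\<lambda>x. P1 x \<and> P3 x \<and> x \<in> carrier G) F1" "eventually (\<lambda>x. P2 x \<and> P4 x \<and> x \<in> carrier G) F2"
      using 1(2,3) 2(2,3) 3(1,2) 4(1,2) assms(3-6) by (auto intro!: eventually_conj simp: cauchy_filter_grp_def)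
    then show "eventually A (filtermap (\<lambda>(x, y). x \<otimes>\<^bsub>G\<^esub> y) (F1 \<times>\<^sub>F F2))"
      unfolding eventually_filtermap eventually_prod_filter A_def prod.case by blast
    have "eventually (\<lambda>x. Q1 x \<and> Q3 x \<and> x \<in> carrier G) F1'" "eventually (\<lambda>x. Q2 x \<and> Q4 x \<and> x \<in> carrier G) F2'"
      using 1(2,3) 2(2,3) 3(1,2) 4(1,2) assms(3-6) by (auto intro!: eventually_conj simp: cauchy_filter_grp_def)
    then show "eventually B (filtermap (\<lambda>(x, y). x \<otimes>\<^bsub>G\<^esub> y) (F1' \<times>\<^sub>F F2'))"
      unfolding eventually_filtermap eventually_prod_filter B_def prod.case by blast
    fix z w assume "A z" "B w"
    then obtain x y x' y' where z: "z = x \<otimes>\<^bsub>G\<^esub> y" "P1 x" "P3 x" "x \<in> carrier G" "P2 y" "P4 y" "y \<in> carrier G"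
      and w: "w = x' \<otimes>\<^bsub>G\<^esub> y'" "Q1 x'" "Q3 x'" "x' \<in> carrier G" "Q2 y'" "Q4 y'" "y' \<in> carrier G"
      unfolding A_def B_def by blast
    have cancel: "a \<otimes>\<^bsub>G\<^esub> (inv\<^bsub>G\<^esub> a \<otimes>\<^bsub>G\<^esub> b) = b" "inv\<^bsub>G\<^esub> a \<otimes>\<^bsub>G\<^esub> (a \<otimes>\<^bsub>G\<^esub> b) = b"
      if "a \<in> carrier G" "b \<in> carrier G" for a b
      using that by (simp_all flip: m_assoc)
    \<comment> \<open>The first product is \<open>(x y)^-1 (x' y')\<close> with \<open>y0\<close>
      inserted, the second is \<open>(x' y') (x y)^-1\<close> with \<open>x0\<close> inserted. The
      outer factors compare with the fixed point, the middle one is conjugated by it.\<close>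
    have "(inv\<^bsub>G\<^esub> y \<otimes>\<^bsub>G\<^esub> y0) \<otimes>\<^bsub>G\<^esub> (inv\<^bsub>G\<^esub> y0 \<otimes>\<^bsub>G\<^esub> (inv\<^bsub>G\<^esub> x \<otimes>\<^bsub>G\<^esub> x') \<otimes>\<^bsub>G\<^esub> y0) \<otimes>\<^bsub>G\<^esub> (inv\<^bsub>G\<^esub> y0 \<otimes>\<^bsub>G\<^esub> y') \<in> U"
      "(x' \<otimes>\<^bsub>G\<^esub> inv\<^bsub>G\<^esub> x0) \<otimes>\<^bsub>G\<^esub> (x0 \<otimes>\<^bsub>G\<^esub> (y' \<otimes>\<^bsub>G\<^esub> inv\<^bsub>G\<^esub> y) \<otimes>\<^bsub>G\<^esub> inv\<^bsub>G\<^esub> x0) \<otimes>\<^bsub>G\<^esub> (x0 \<otimes>\<^bsub>G\<^esub> inv\<^bsub>G\<^esub> x) \<in> U"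
      using 1(1,4,5) 2(1,4,5) 3(3)[of x x'] 4(3)[of y y'] z w by (auto simp: N_def intro!: V(3))
    then show "case (z, w) of (x, y) \<Rightarrow> inv\<^bsub>G\<^esub> x \<otimes>\<^bsub>G\<^esub> y \<in> U \<and> y \<otimes>\<^bsub>G\<^esub> inv\<^bsub>G\<^esub> x \<in> U"
      using z w 1(1) 2(1) by (simp add: m_assoc inv_mult_group cancel)
  qed
qed

section \<open>Products and powers of points of the completion\<close>

lemma cauchy_filter_mult:
  assumes "cauchy_filter_grp G T F1" "cauchy_filter_grp G T F2"
  shows "cauchy_filter_grp G T (filtermap (\<lambda>(x, y). x \<otimes>\<^bsub>G\<^esub> y) (F1 \<times>\<^sub>F F2))"
  unfolding cauchy_filter_grp_def
proof (intro conjI)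
  show "filtermap (\<lambda>(x, y). x \<otimes>\<^bsub>G\<^esub> y) (F1 \<times>\<^sub>F F2) \<noteq> bot"
    using assms by (simp add: cauchy_filter_grp_def filtermap_bot_iff prod_filter_eq_bot)
  show "eventually (\<lambda>x. x \<in> carrier G) (filtermap (\<lambda>(x, y). x \<otimes>\<^bsub>G\<^esub> y) (F1 \<times>\<^sub>F F2))"
    using assms unfolding cauchy_filter_grp_def eventually_filtermap eventually_prod_filter
    by (intro exI[of _ "\<lambda>x. x \<in> carrier G"]) auto
  show "two_sided_close G T (filtermap (\<lambda>(x, y). x \<otimes>\<^bsub>G\<^esub> y) (F1 \<times>\<^sub>F F2)) (filtermap (\<lambda>(x, y). x \<otimes>\<^bsub>G\<^esub> y) (F1 \<times>\<^sub>F F2))"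
    using assms by (intro two_sided_close_mult) (auto simp: cauchy_filter_grp_def)
qed

lemma cauchy_filter_some:
  assumes "cauchy_filter_grp G T F"
  defines "F' \<equiv> SOME F'. F' \<in> cauchy_class G T F"
  shows "cauchy_filter_grp G T F'" "two_sided_close G T F F'"
proof -
  have "F \<in> cauchy_class G T F" using assms(1) by (auto simp: cauchy_class_def cauchy_filter_grp_def)
  then have "F' \<in> cauchy_class G T F" unfolding F'_def by (rule someI)
  then show "cauchy_filter_grp G T F'" "two_sided_close G T F F'" by (auto simp: cauchy_class_def)
qed

text \<open>The definition multiplies representatives picked by \<open>SOME\<close>. These are close
  to \<open>F1\<close> and \<open>F2\<close>, and products of close filters are close, so every
  choice gives the same class.\<close>

lemma completion_mult_class:
  assumes "cauchy_filter_grp G T F1" "cauchy_filter_grp G T F2"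
  shows "cauchy_class G T F1 \<otimes>\<^bsub>completion_grp G T\<^esub> cauchy_class G T F2
    = cauchy_class G T (filtermap (\<lambda>(x, y). x \<otimes>\<^bsub>G\<^esub> y) (F1 \<times>\<^sub>F F2))"
proof -
  let ?F1 = "SOME F. F \<in> cauchy_class G T F1" and ?F2 = "SOME F. F \<in> cauchy_class G T F2"
  note F = cauchy_filter_some[OF assms(1)] cauchy_filter_some[OF assms(2)]
  have "two_sided_close G T (filtermap (\<lambda>(x, y). x \<otimes>\<^bsub>G\<^esub> y) (F1 \<times>\<^sub>F F2))
      (filtermap (\<lambda>(x, y). x \<otimes>\<^bsub>G\<^esub> y) (?F1 \<times>\<^sub>F ?F2))"
    using assms F by (intro two_sided_close_mult)
  then have "cauchy_class G T (filtermap (\<lambda>(x, y). x \<otimes>\<^bsub>G\<^esub> y) (F1 \<times>\<^sub>F F2))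
      = cauchy_class G T (filtermap (\<lambda>(x, y). x \<otimes>\<^bsub>G\<^esub> y) (?F1 \<times>\<^sub>F ?F2))"
    using assms F by (simp add: cauchy_class_eq_iff cauchy_filter_mult)
  then show ?thesis by (simp add: completion_grp_def)
qed

lemma cauchy_filter_principal:
  "a \<in> carrier G \<Longrightarrow> cauchy_filter_grp G T (principal {a})"
  by (simp add: cauchy_filter_grp_def two_sided_close_def eventually_principal principal_prod_principal principal_eq_bot_iff)

text \<open>Iterated multiplication yields a product filter, in which the factors vary
  independently. The filter of actual powers \<open>x^m\<close> is its restriction to the diagonal;
  it is finer, hence Cauchy and in the same class.\<close>

lemma completion_pow_class:
  assumes "cauchy_filter_grp G T F"
  shows "cauchy_filter_grp G T (filtermap (\<lambda>x. x [^]\<^bsub>G\<^esub> m) F) \<and>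
    cauchy_class G T F [^]\<^bsub>completion_grp G T\<^esub> m = cauchy_class G T (filtermap (\<lambda>x. x [^]\<^bsub>G\<^esub> (m::nat)) F)"
proof (induction m)
  case 0
  \<comment> \<open>A constant map sends a proper filter to a principal one, but \<open>bot\<close>
    to \<open>bot\<close>.\<close>
  have "F \<noteq> bot" using assms by (simp add: cauchy_filter_grp_def)
  then have "filtermap (\<lambda>x. \<one>\<^bsub>G\<^esub>) F = principal {\<one>\<^bsub>G\<^esub>}"
    by (auto simp: filter_eq_iff eventually_filtermap eventually_principal)
  then show ?case by (simp add: cauchy_filter_principal) (simp add: completion_grp_def)
next
  case (Suc m)
  let ?P = "filtermap (\<lambda>x. x [^]\<^bsub>G\<^esub> m) F"
  let ?M = "filtermap (\<lambda>(x, y). x \<otimes>\<^bsub>G\<^esub> y) (?P \<times>\<^sub>F F)"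
  let ?S = "filtermap (\<lambda>x. x [^]\<^bsub>G\<^esub> Suc m) F"
  have cM: "cauchy_filter_grp G T ?M" using Suc assms by (simp add: cauchy_filter_mult)
  \<comment> \<open>A product of sets from both filters contains the pairs \<open>(x^m, x)\<close>
    for eventually all \<open>x\<close>.\<close>
  have le: "?S \<le> ?M"
  proof (rule filter_leI)
    fix Q assume "eventually Q ?M"
    then obtain A B where AB: "eventually (\<lambda>x. A (x [^]\<^bsub>G\<^esub> m)) F" "eventually B F"
      and Q: "\<forall>x y. A x \<longrightarrow> B y \<longrightarrow> Q (x \<otimes>\<^bsub>G\<^esub> y)"
      unfolding eventually_filtermap eventually_prod_filter prod.case by blast
    from AB have "eventually (\<lambda>x. Q (x [^]\<^bsub>G\<^esub> m \<otimes>\<^bsub>G\<^esub> x)) F"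
      by (rule eventually_elim2) (use Q in blast)
    then show "eventually Q ?S" by (simp add: eventually_filtermap)
  qed
  have cS: "cauchy_filter_grp G T ?S" "two_sided_close G T ?M ?S"
    using cM le assms two_sided_close_finer[OF le]
    by (auto simp: cauchy_filter_grp_def filtermap_bot_iff eventually_filtermap elim: eventually_mono)
  moreover have "cauchy_class G T F [^]\<^bsub>completion_grp G T\<^esub> Suc m = cauchy_class G T ?M"
    using Suc assms by (simp add: completion_mult_class)
  ultimately show ?case using cauchy_class_eq_iff[OF cM cS(1)] by blast
qed

end

section \<open>Homomorphisms on dense subgroups\<close>

text \<open>The principal filter at \<open>g\<close> represents \<open>g\<close> in the completion.
  An \<open>n\<close>-th root of its class is a Cauchy filter whose \<open>n\<close>-th powers
  converge to \<open>g\<close>, so they enter every neighbourhood of \<open>g\<close>.\<close>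

lemma dense_powers_of_completion_powers:
  assumes tg: "topological_group G T"
    and "power_set_grp (completion_grp G T) n = carrier (completion_grp G T)"
  shows "T closure_of (power_set_grp G n) = carrier G"
proof -
  interpret group G by (rule topological_group_group[OF tg])
  note top = topological_group_topspace[OF tg]
  have "power_set_grp G n \<inter> W \<noteq> {}" if W: "openin T W" "W \<noteq> {}" for W
  proof -
    from W obtain g where g: "g \<in> W" "g \<in> carrier G"
      using openin_subset top by blast
    let ?E = "cauchy_class G T (principal {g})"
    have "?E \<in> power_set_grp (completion_grp G T) n"
      using assms(2) cauchy_filter_principal[OF tg g(2)] by (auto simp: completion_grp_def)
    then obtain F where F: "cauchy_filter_grp G T F" "?E = cauchy_class G T F [^]\<^bsub>completion_grp G T\<^esub> n"
      by (auto simp: power_set_grp_def completion_grp_def)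
    note pow = completion_pow_class[OF tg F(1), of n]
    have "two_sided_close G T (filtermap (\<lambda>x. x [^]\<^bsub>G\<^esub> n) F) (principal {g})"
      using cauchy_class_eq_iff[OF tg pow[THEN conjunct1] cauchy_filter_principal[OF tg g(2)]] pow F(2) by simp
    \<comment> \<open>Chosen so that \<open>u = (x^n)^-1 g\<close> in \<open>U\<close> means
      \<open>g u^-1 = x^n\<close> in \<open>W\<close>.\<close>
    moreover define U where "U = {u \<in> carrier G. g \<otimes>\<^bsub>G\<^esub> inv\<^bsub>G\<^esub> u \<in> W}"
    moreover have cont: "continuous_map T T (\<lambda>u. g \<otimes>\<^bsub>G\<^esub> inv\<^bsub>G\<^esub> u)"
      using g(2) by (intro topological_group_continuous_mult[OF tg] topological_group_continuous_inv[OF tg]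
        topological_group_continuous_const[OF tg]) auto
    have "openin T U"
      using openin_continuous_map_preimage[OF cont W(1)] by (simp add: U_def top)
    moreover have "\<one>\<^bsub>G\<^esub> \<in> U" using g by (simp add: U_def)
    ultimately obtain A B where AB: "eventually A (filtermap (\<lambda>x. x [^]\<^bsub>G\<^esub> n) F)" "eventually B (principal {g})"
      "\<And>x y. A x \<Longrightarrow> B y \<Longrightarrow> inv\<^bsub>G\<^esub> x \<otimes>\<^bsub>G\<^esub> y \<in> U \<and> y \<otimes>\<^bsub>G\<^esub> inv\<^bsub>G\<^esub> x \<in> U"
      using two_sided_closeD[OF tg] by blast
    have "eventually (\<lambda>x. A (x [^]\<^bsub>G\<^esub> n) \<and> x \<in> carrier G) F" "F \<noteq> bot"
      using AB(1) F(1) by (auto simp: eventually_filtermap cauchy_filter_grp_def intro: eventually_conj)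
    then obtain x where x: "A (x [^]\<^bsub>G\<^esub> n)" "x \<in> carrier G" using eventually_happens' by blast
    then have "inv\<^bsub>G\<^esub> (x [^]\<^bsub>G\<^esub> n) \<otimes>\<^bsub>G\<^esub> g \<in> U" using AB by (auto simp: eventually_principal)
    then have "x [^]\<^bsub>G\<^esub> n \<in> W"
      using x g by (simp add: U_def inv_mult_group flip: m_assoc)
    then show ?thesis using x by (auto simp: power_set_grp_def)
  qed
  then show ?thesis using dense_intersects_open[of T "power_set_grp G n"] top by auto
qed

text \<open>The hypothesis \<open>conv\<close> says that the class of \<open>F\<close> has trivial
  \<open>m\<close>-th power; torsion-freeness makes the class trivial, which means that
  \<open>F\<close> converges to one.\<close>

lemma torsion_free_completion_converges:
  assumes tg: "topological_group G T" and tf: "torsion_free (completion_grp G T)"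
    and F: "cauchy_filter_grp G T F" and m: "m \<ge> (1::nat)"
    and conv: "two_sided_close G T (filtermap (\<lambda>x. x [^]\<^bsub>G\<^esub> m) F) (principal {\<one>\<^bsub>G\<^esub>})"
    and U: "openin T U" "\<one>\<^bsub>G\<^esub> \<in> U"
  shows "eventually (\<lambda>x. x \<in> U) F"
proof -
  interpret group G by (rule topological_group_group[OF tg])
  let ?K = "completion_grp G T"
  note pow = completion_pow_class[OF tg F, of m]
  have one: "cauchy_filter_grp G T (principal {\<one>\<^bsub>G\<^esub>})" by (simp add: cauchy_filter_principal[OF tg])
  have "cauchy_class G T F [^]\<^bsub>?K\<^esub> m = \<one>\<^bsub>?K\<^esub>"
    using cauchy_class_eq_iff[OF tg pow[THEN conjunct1] one] conv pow
    by (simp add: completion_grp_def[of G T])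
  moreover have "cauchy_class G T F \<in> carrier ?K" using F by (auto simp: completion_grp_def)
  ultimately have "cauchy_class G T F = \<one>\<^bsub>?K\<^esub>"
    using tf m by (auto simp: torsion_free_def torsion_part_def)
  then have cl: "two_sided_close G T F (principal {\<one>\<^bsub>G\<^esub>})"
    using cauchy_class_eq_iff[OF tg F one] by (simp add: completion_grp_def)
  \<comment> \<open>Closeness to the principal filter at one controls \<open>x^-1\<close> and not
    \<open>x\<close>, hence a \<open>V\<close> closed under inversion.\<close>
  obtain V where V: "openin T V" "\<one>\<^bsub>G\<^esub> \<in> V" "\<And>x y. x \<in> V \<Longrightarrow> y \<in> V \<Longrightarrow> x \<otimes>\<^bsub>G\<^esub> y \<in> U"
    "\<And>x. x \<in> V \<Longrightarrow> inv\<^bsub>G\<^esub> x \<in> V" using topological_group_small[OF tg U] by blast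
  obtain A B where AB: "eventually A F" "eventually B (principal {\<one>\<^bsub>G\<^esub>})"
    "\<And>x y. A x \<Longrightarrow> B y \<Longrightarrow> inv\<^bsub>G\<^esub> x \<otimes>\<^bsub>G\<^esub> y \<in> V \<and> y \<otimes>\<^bsub>G\<^esub> inv\<^bsub>G\<^esub> x \<in> V"
    using two_sided_closeD[OF tg cl V(1,2)] by blast
  have "eventually (\<lambda>x. x \<in> carrier G) F" using F by (simp add: cauchy_filter_grp_def)
  with AB(1) show ?thesis
  proof (rule eventually_elim2)
    fix x assume "A x" and x: "x \<in> carrier G"
    then have "inv\<^bsub>G\<^esub> x \<in> V" using AB(3)[of x "\<one>\<^bsub>G\<^esub>"] AB(2) by (simp add: eventually_principal)
    then have "x \<in> V" using V(4)[of "inv\<^bsub>G\<^esub> x"] x by simp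
    then show "x \<in> U" using V(3)[OF _ V(2), of x] x by simp
  qed
qed

lemma two_sided_close_nhdsin:
  assumes tg: "topological_group G T" and t: "t \<in> carrier G"
  shows "two_sided_close G T (nhdsin T t) (nhdsin T t)"
  unfolding two_sided_close_def
proof (intro allI impI, elim conjE)
  interpret group G by (rule topological_group_group[OF tg])
  note top = topological_group_topspace[OF tg]
  fix U assume "openin T U" "\<one>\<^bsub>G\<^esub> \<in> U"
  then obtain V where V: "openin T V" "\<one>\<^bsub>G\<^esub> \<in> V" "\<And>x y. x \<in> V \<Longrightarrow> y \<in> V \<Longrightarrow> x \<otimes>\<^bsub>G\<^esub> y \<in> U"
    "\<And>x. x \<in> V \<Longrightarrow> inv\<^bsub>G\<^esub> x \<in> V" using topological_group_small[OF tg] by blast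
  \<comment> \<open>This is the intersection of \<open>t V\<close> and \<open>V t\<close>: the left
    translate controls \<open>x^-1 y\<close>, the right one \<open>y x^-1\<close>.\<close>
  define W where "W = {w \<in> carrier G. inv\<^bsub>G\<^esub> t \<otimes>\<^bsub>G\<^esub> w \<in> V} \<inter> {w \<in> carrier G. w \<otimes>\<^bsub>G\<^esub> inv\<^bsub>G\<^esub> t \<in> V}"
  have "continuous_map T T (\<lambda>w. inv\<^bsub>G\<^esub> t \<otimes>\<^bsub>G\<^esub> w)" "continuous_map T T (\<lambda>w. w \<otimes>\<^bsub>G\<^esub> inv\<^bsub>G\<^esub> t)"
    using t by (intro topological_group_continuous_mult[OF tg] topological_group_continuous_const[OF tg]; simp)+
  from this[THEN openin_continuous_map_preimage, OF V(1)] have W: "openin T W" "t \<in> W"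
    using t V(2) by (auto simp: W_def top)
  have "inv\<^bsub>G\<^esub> x \<otimes>\<^bsub>G\<^esub> y \<in> U \<and> y \<otimes>\<^bsub>G\<^esub> inv\<^bsub>G\<^esub> x \<in> U" if "x \<in> W" "y \<in> W" for x y
  proof -
    have "inv\<^bsub>G\<^esub> (inv\<^bsub>G\<^esub> t \<otimes>\<^bsub>G\<^esub> x) \<otimes>\<^bsub>G\<^esub> (inv\<^bsub>G\<^esub> t \<otimes>\<^bsub>G\<^esub> y) \<in> U"
      "(y \<otimes>\<^bsub>G\<^esub> inv\<^bsub>G\<^esub> t) \<otimes>\<^bsub>G\<^esub> inv\<^bsub>G\<^esub> (x \<otimes>\<^bsub>G\<^esub> inv\<^bsub>G\<^esub> t) \<in> U"
      using that by (auto simp: W_def intro!: V(3,4))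
    moreover have "t \<otimes>\<^bsub>G\<^esub> (inv\<^bsub>G\<^esub> t \<otimes>\<^bsub>G\<^esub> z) = z" "inv\<^bsub>G\<^esub> t \<otimes>\<^bsub>G\<^esub> (t \<otimes>\<^bsub>G\<^esub> z) = z" if "z \<in> carrier G" for z
      using t that by (simp_all flip: m_assoc)
    ultimately show ?thesis using that t by (simp add: W_def inv_mult_group m_assoc)
  qed
  then show "eventually (\<lambda>(x, y). inv\<^bsub>G\<^esub> x \<otimes>\<^bsub>G\<^esub> y \<in> U \<and> y \<otimes>\<^bsub>G\<^esub> inv\<^bsub>G\<^esub> x \<in> U) (nhdsin T t \<times>\<^sub>F nhdsin T t)"
    unfolding eventually_prod_filter eventually_nhdsin prod.case
    using W by (intro exI[of _ "\<lambda>x. x \<in> W"]) blast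
qed

section \<open>Vanishing of homomorphisms defined on a dense subgroup\<close>

text \<open>Applied with \<open>P\<close> the power \<open>G^X\<close> and \<open>C\<close> the
  subgroup \<open>C_p(X,G)\<close>. Torsion elements and powers are plentiful in \<open>P\<close>
  but may lie outside \<open>C\<close>, where \<open>\<psi>\<close> has no meaning, so each use of
  them passes to nearby points of \<open>C\<close>.\<close>

locale dense_subgroup_hom =
  fixes P :: "('p, 'm) monoid_scheme" and TP and C and H :: "('h, 'n) monoid_scheme" and TH \<psi>
  assumes P: "topological_group P TP" and H: "topological_group H TH"
    and C: "subgroup C P" and dense: "TP closure_of C = carrier P"
    and hom: "\<psi> \<in> hom (P\<lparr>carrier := C\<rparr>) H"
    and cont: "continuous_map (subtopology TP C) TH \<psi>"
begin

sublocale P: group P by (rule topological_group_group[OF P])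
sublocale H: group H by (rule topological_group_group[OF H])
sublocale C: subgroup C P by (rule C)

lemma psi_closed: "x \<in> C \<Longrightarrow> \<psi> x \<in> carrier H"
  and psi_mult: "x \<in> C \<Longrightarrow> y \<in> C \<Longrightarrow> \<psi> (x \<otimes>\<^bsub>P\<^esub> y) = \<psi> x \<otimes>\<^bsub>H\<^esub> \<psi> y"
  using hom by (auto simp: hom_def)

lemma psi_one: "\<psi> \<one>\<^bsub>P\<^esub> = \<one>\<^bsub>H\<^esub>"
  using psi_mult[of "\<one>\<^bsub>P\<^esub>" "\<one>\<^bsub>P\<^esub>"] psi_closed[of "\<one>\<^bsub>P\<^esub>"] by simp

lemma psi_inv: "x \<in> C \<Longrightarrow> \<psi> (inv\<^bsub>P\<^esub> x) = inv\<^bsub>H\<^esub> (\<psi> x)"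
  using psi_mult[of "inv\<^bsub>P\<^esub> x" x] by (simp add: psi_closed psi_one H.inv_equality)

lemma pow_closed: "x \<in> C \<Longrightarrow> x [^]\<^bsub>P\<^esub> (n::nat) \<in> C"
  by (induction n) auto

lemma psi_pow: "x \<in> C \<Longrightarrow> \<psi> (x [^]\<^bsub>P\<^esub> (n::nat)) = \<psi> x [^]\<^bsub>H\<^esub> n"
  by (induction n) (auto simp: psi_one psi_mult pow_closed)

lemma meets: "openin TP W \<Longrightarrow> w \<in> W \<Longrightarrow> \<exists>x\<in>C. x \<in> W"
  using dense dense_intersects_open[of TP C] topological_group_topspace[OF P] by auto

lemma psi_small:
  assumes "openin TH U" "\<one>\<^bsub>H\<^esub> \<in> U"
  obtains N where "openin TP N" "\<one>\<^bsub>P\<^esub> \<in> N" "\<And>x. x \<in> N \<Longrightarrow> x \<in> C \<Longrightarrow> \<psi> x \<in> U"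
proof -
  have "openin (subtopology TP C) {x \<in> topspace (subtopology TP C). \<psi> x \<in> U}"
    by (rule openin_continuous_map_preimage[OF cont assms(1)])
  moreover have "topspace (subtopology TP C) = C"
    using C.subset topological_group_topspace[OF P] by auto
  ultimately have "openin (subtopology TP C) {x \<in> C. \<psi> x \<in> U}" by (simp only:)
  then obtain N where N: "openin TP N" "{x \<in> C. \<psi> x \<in> U} = N \<inter> C"
    unfolding openin_subtopology by blast
  have "\<one>\<^bsub>P\<^esub> \<in> {x \<in> C. \<psi> x \<in> U}" using psi_one assms(2) C.one_closed by simp
  then have "\<one>\<^bsub>P\<^esub> \<in> N" unfolding N(2) by blast
  with N show ?thesis using that by blast
qed

lemma translate_open:
  assumes "openin TP N" "a \<in> carrier P"
  shows "openin TP {w \<in> carrier P. inv\<^bsub>P\<^esub> a \<otimes>\<^bsub>P\<^esub> w \<in> N}"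
proof -
  have "continuous_map TP TP (\<lambda>w. inv\<^bsub>P\<^esub> a \<otimes>\<^bsub>P\<^esub> w)"
    using assms by (intro topological_group_continuous_mult[OF P] topological_group_continuous_const[OF P]) auto
  from openin_continuous_map_preimage[OF this assms(1)] show ?thesis
    by (simp add: topological_group_topspace[OF P])
qed

lemma psi_continuous_at:
  assumes "c \<in> C" "openin TH U" "\<one>\<^bsub>H\<^esub> \<in> U"
  obtains W where "openin TP W" "c \<in> W" "\<And>w. w \<in> W \<Longrightarrow> w \<in> C \<Longrightarrow> inv\<^bsub>H\<^esub> (\<psi> c) \<otimes>\<^bsub>H\<^esub> \<psi> w \<in> U"
proof -
  obtain N where N: "openin TP N" "\<one>\<^bsub>P\<^esub> \<in> N" "\<And>x. x \<in> N \<Longrightarrow> x \<in> C \<Longrightarrow> \<psi> x \<in> U"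
    using psi_small[OF assms(2,3)] by blast
  show ?thesis
  proof (rule that[OF translate_open[OF N(1)]])
    show c: "c \<in> carrier P" "c \<in> {w \<in> carrier P. inv\<^bsub>P\<^esub> c \<otimes>\<^bsub>P\<^esub> w \<in> N}" using assms(1) N(2) by auto
    show "inv\<^bsub>H\<^esub> (\<psi> c) \<otimes>\<^bsub>H\<^esub> \<psi> w \<in> U" if "w \<in> {w \<in> carrier P. inv\<^bsub>P\<^esub> c \<otimes>\<^bsub>P\<^esub> w \<in> N}" "w \<in> C" for w
      using N(3)[of "inv\<^bsub>P\<^esub> c \<otimes>\<^bsub>P\<^esub> w"] that assms(1) by (simp add: psi_mult psi_inv)
  qed
qed

text \<open>Arbitrarily near \<open>c\<close> there are elements \<open>h^n\<close> with
  \<open>h\<close> in \<open>C\<close>, and \<open>\<psi>\<close> sends each of them to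
  \<open>(\<psi> h)^n\<close>, which is one. Continuity at \<open>c\<close> then forces
  \<open>\<psi> c\<close> to be one.\<close>

lemma hom_trivial_divisible:
  assumes pow: "TP closure_of (power_set_grp P n) = carrier P"
    and exp: "power_set_grp H n = {\<one>\<^bsub>H\<^esub>}" and c: "c \<in> C"
  shows "\<psi> c = \<one>\<^bsub>H\<^esub>"
proof -
  have "inv\<^bsub>H\<^esub> (\<psi> c) \<in> U" if U: "openin TH U" "\<one>\<^bsub>H\<^esub> \<in> U" for U
  proof -
    obtain W where W: "openin TP W" "c \<in> W" "\<And>w. w \<in> W \<Longrightarrow> w \<in> C \<Longrightarrow> inv\<^bsub>H\<^esub> (\<psi> c) \<otimes>\<^bsub>H\<^esub> \<psi> w \<in> U"
      using psi_continuous_at[OF c U] by blast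
    have "power_set_grp P n \<inter> W \<noteq> {}"
      using pow dense_intersects_open[of TP "power_set_grp P n"] topological_group_topspace[OF P] W(1,2) by auto
    then obtain p where p: "p \<in> carrier P" "p [^]\<^bsub>P\<^esub> n \<in> W" by (auto simp: power_set_grp_def)
    \<comment> \<open>The root \<open>p\<close> may lie outside \<open>C\<close>, but the roots of
      points of \<open>W\<close> form an open set, and this set meets \<open>C\<close>.\<close>
    have "continuous_map TP TP (\<lambda>x. x [^]\<^bsub>P\<^esub> n)"
      by (rule topological_group_continuous_pow[OF P]) simp
    from openin_continuous_map_preimage[OF this W(1)]
    have "openin TP {x \<in> topspace TP. x [^]\<^bsub>P\<^esub> n \<in> W}" .
    from meets[OF this, of p] p obtain h where h: "h \<in> C" "h [^]\<^bsub>P\<^esub> n \<in> W"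
      by (auto simp: topological_group_topspace[OF P])
    have "\<psi> h [^]\<^bsub>H\<^esub> n = \<one>\<^bsub>H\<^esub>" using exp psi_closed[OF h(1)] by (auto simp: power_set_grp_def)
    then show ?thesis
      using W(3)[OF h(2) pow_closed[OF h(1)]] h(1) c by (simp add: psi_pow psi_closed)
  qed
  then have "inv\<^bsub>H\<^esub> (\<psi> c) = \<one>\<^bsub>H\<^esub>"
    using topological_group_separate[OF H] psi_closed[OF c] by simp
  then show ?thesis using psi_closed[OF c] by simp
qed

text \<open>In a completion of \<open>H\<close> the homomorphism would extend to the torsion point \<open>t\<close>, with a
  torsion value; the image of the neighbourhood filter of \<open>t\<close> stands in for this value.\<close>

lemma psi_small_near_torsion:
  assumes tf: "torsion_free (completion_grp H TH)" and t: "t \<in> torsion_part P"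
    and U: "openin TH U" "\<one>\<^bsub>H\<^esub> \<in> U"
  obtains W where "openin TP W" "t \<in> W" "\<And>w. w \<in> W \<Longrightarrow> w \<in> C \<Longrightarrow> \<psi> w \<in> U"
proof -
  obtain m where m: "t \<in> carrier P" "m \<ge> (1::nat)" "t [^]\<^bsub>P\<^esub> m = \<one>\<^bsub>P\<^esub>"
    using t by (auto simp: torsion_part_def)
  \<comment> \<open>The trace on \<open>C\<close> of the neighbourhood filter of \<open>t\<close>;
    density of \<open>C\<close> makes it proper.\<close>
  define F where "F = inf (nhdsin TP t) (principal C)"
  have ev: "eventually Q F \<longleftrightarrow> (\<exists>W. openin TP W \<and> t \<in> W \<and> (\<forall>w\<in>W. w \<in> C \<longrightarrow> Q w))" for Q
    unfolding F_def eventually_inf_principal eventually_nhdsin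
    using m(1) topological_group_topspace[OF P] by simp
  have "F \<noteq> bot" unfolding trivial_limit_def ev using meets by blast
  have FC: "eventually (\<lambda>x. x \<in> C) F" by (simp add: F_def eventually_inf_principal)
  have FF: "two_sided_close P TP F F"
    by (rule two_sided_close_finer(2)[OF P _ two_sided_close_nhdsin[OF P m(1)]]) (simp add: F_def)
  let ?E = "filtermap \<psi> F"
  \<comment> \<open>A continuous homomorphism is uniformly continuous, so it preserves Cauchy
    filters although \<open>t\<close> itself may have no image.\<close>
  have "two_sided_close H TH ?E ?E"
    unfolding two_sided_close_def
  proof (intro allI impI, elim conjE)
    fix U assume "openin TH U" "\<one>\<^bsub>H\<^esub> \<in> U"
    then obtain N where N: "openin TP N" "\<one>\<^bsub>P\<^esub> \<in> N" "\<And>x. x \<in> N \<Longrightarrow> x \<in> C \<Longrightarrow> \<psi> x \<in> U"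
      using psi_small by blast
    obtain A B where AB: "eventually A F" "eventually B F"
      "\<And>x y. A x \<Longrightarrow> B y \<Longrightarrow> inv\<^bsub>P\<^esub> x \<otimes>\<^bsub>P\<^esub> y \<in> N \<and> y \<otimes>\<^bsub>P\<^esub> inv\<^bsub>P\<^esub> x \<in> N"
      using two_sided_closeD[OF P FF N(1,2)] by blast
    show "eventually (\<lambda>(x, y). inv\<^bsub>H\<^esub> x \<otimes>\<^bsub>H\<^esub> y \<in> U \<and> y \<otimes>\<^bsub>H\<^esub> inv\<^bsub>H\<^esub> x \<in> U) (?E \<times>\<^sub>F ?E)"
      unfolding eventually_prod_filter eventually_filtermap prod.case
    proof (rule exI[of _ "\<lambda>z. \<exists>x. z = \<psi> x \<and> A x \<and> x \<in> C"], rule exI[of _ "\<lambda>z. \<exists>x. z = \<psi> x \<and> B x \<and> x \<in> C"],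
        intro conjI allI impI; (elim exE conjE)?)
      show "eventually (\<lambda>x. \<exists>xa. \<psi> x = \<psi> xa \<and> A xa \<and> xa \<in> C) F"
        using eventually_conj[OF AB(1) FC] by (rule eventually_mono) blast
      show "eventually (\<lambda>x. \<exists>xa. \<psi> x = \<psi> xa \<and> B xa \<and> xa \<in> C) F"
        using eventually_conj[OF AB(2) FC] by (rule eventually_mono) blast
      fix x y a b assume "x = \<psi> a" "A a" "a \<in> C" "y = \<psi> b" "B b" "b \<in> C"
      then show "inv\<^bsub>H\<^esub> x \<otimes>\<^bsub>H\<^esub> y \<in> U" "y \<otimes>\<^bsub>H\<^esub> inv\<^bsub>H\<^esub> x \<in> U"
        using AB(3)[of a b] N(3)[of "inv\<^bsub>P\<^esub> a \<otimes>\<^bsub>P\<^esub> b"] N(3)[of "b \<otimes>\<^bsub>P\<^esub> inv\<^bsub>P\<^esub> a"]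
        by (auto simp: psi_mult psi_inv)
    qed
  qed
  then have cauchy: "cauchy_filter_grp H TH ?E"
    using \<open>F \<noteq> bot\<close> FC
    by (auto simp: cauchy_filter_grp_def filtermap_bot_iff eventually_filtermap psi_closed elim: eventually_mono)
  \<comment> \<open>Near \<open>t\<close> the powers \<open>x^m\<close> are near \<open>t^m\<close>,
    which is one, and there \<open>\<psi>\<close> is small. So the \<open>m\<close>-th powers of the
    image filter converge to one.\<close>
  have "two_sided_close H TH (filtermap (\<lambda>x. x [^]\<^bsub>H\<^esub> m) ?E) (principal {\<one>\<^bsub>H\<^esub>})"
    unfolding two_sided_close_def
  proof (intro allI impI, elim conjE)
    fix U assume "openin TH U" "\<one>\<^bsub>H\<^esub> \<in> U"
    then obtain V where V: "openin TH V" "\<one>\<^bsub>H\<^esub> \<in> V" "\<And>x y. x \<in> V \<Longrightarrow> y \<in> V \<Longrightarrow> x \<otimes>\<^bsub>H\<^esub> y \<in> U"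
      "\<And>x. x \<in> V \<Longrightarrow> inv\<^bsub>H\<^esub> x \<in> V" using topological_group_small[OF H] by blast
    obtain N where N: "openin TP N" "\<one>\<^bsub>P\<^esub> \<in> N" "\<And>x. x \<in> N \<Longrightarrow> x \<in> C \<Longrightarrow> \<psi> x \<in> V"
      using psi_small[OF V(1,2)] by blast
    have "continuous_map TP TP (\<lambda>x. x [^]\<^bsub>P\<^esub> m)"
      by (rule topological_group_continuous_pow[OF P]) simp
    from openin_continuous_map_preimage[OF this N(1)]
    have "eventually (\<lambda>x. x [^]\<^bsub>P\<^esub> m \<in> N) F"
      unfolding ev using m N(2) topological_group_topspace[OF P]
      by (intro exI[of _ "{x \<in> topspace TP. x [^]\<^bsub>P\<^esub> m \<in> N}"]) auto
    \<comment> \<open>The inverse appears because closeness to the principal filter at one is tested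
      on \<open>x^-1\<close>.\<close>
    with FC have evU: "eventually (\<lambda>x. inv\<^bsub>H\<^esub> (\<psi> x [^]\<^bsub>H\<^esub> m) \<in> U) F"
    proof (rule eventually_elim2)
      fix x assume x: "x \<in> C" "x [^]\<^bsub>P\<^esub> m \<in> N"
      then have "inv\<^bsub>H\<^esub> (\<psi> x [^]\<^bsub>H\<^esub> m) \<in> V" using N(3)[OF x(2) pow_closed] V(4) by (simp add: psi_pow)
      then show "inv\<^bsub>H\<^esub> (\<psi> x [^]\<^bsub>H\<^esub> m) \<in> U" using V(3)[OF _ V(2), of "inv\<^bsub>H\<^esub> (\<psi> x [^]\<^bsub>H\<^esub> m)"] x(1) by (simp add: psi_closed)
    qed
    show "eventually (\<lambda>(x, y). inv\<^bsub>H\<^esub> x \<otimes>\<^bsub>H\<^esub> y \<in> U \<and> y \<otimes>\<^bsub>H\<^esub> inv\<^bsub>H\<^esub> x \<in> U)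
        (filtermap (\<lambda>x. x [^]\<^bsub>H\<^esub> m) ?E \<times>\<^sub>F principal {\<one>\<^bsub>H\<^esub>})"
      unfolding eventually_prod_filter eventually_filtermap eventually_principal prod.case
    proof (rule exI[of _ "\<lambda>x. x \<in> carrier H \<and> inv\<^bsub>H\<^esub> x \<in> U"], rule exI[of _ "\<lambda>y. y = \<one>\<^bsub>H\<^esub>"], intro conjI)
      show "eventually (\<lambda>x. \<psi> x [^]\<^bsub>H\<^esub> m \<in> carrier H \<and> inv\<^bsub>H\<^esub> (\<psi> x [^]\<^bsub>H\<^esub> m) \<in> U) F"
        using eventually_conj[OF FC evU] by (rule eventually_mono) (simp add: psi_closed)
    qed simp_all
  qed
  from torsion_free_completion_converges[OF H tf cauchy m(2) this U]
  show ?thesis using that unfolding eventually_filtermap ev by blast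
qed

text \<open>Take a torsion point \<open>t\<close> near \<open>c\<close>, then \<open>h\<close> in
  \<open>C\<close> near \<open>t\<close> and still near \<open>c\<close>. Nearness to
  \<open>t\<close> makes \<open>\<psi> h\<close> small, nearness to \<open>c\<close> makes
  \<open>\<psi> h\<close> close to \<open>\<psi> c\<close>.\<close>

lemma hom_trivial_torsion:
  assumes tor: "TP closure_of (torsion_part P) = carrier P"
    and tf: "torsion_free (completion_grp H TH)" and c: "c \<in> C"
  shows "\<psi> c = \<one>\<^bsub>H\<^esub>"
proof -
  have "\<psi> c \<in> U" if U: "openin TH U" "\<one>\<^bsub>H\<^esub> \<in> U" for U
  proof -
    obtain V where V: "openin TH V" "\<one>\<^bsub>H\<^esub> \<in> V" "\<And>x y. x \<in> V \<Longrightarrow> y \<in> V \<Longrightarrow> x \<otimes>\<^bsub>H\<^esub> y \<in> U"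
      "\<And>x. x \<in> V \<Longrightarrow> inv\<^bsub>H\<^esub> x \<in> V" using topological_group_small[OF H U] by blast
    obtain W0 where W0: "openin TP W0" "c \<in> W0" "\<And>w. w \<in> W0 \<Longrightarrow> w \<in> C \<Longrightarrow> inv\<^bsub>H\<^esub> (\<psi> c) \<otimes>\<^bsub>H\<^esub> \<psi> w \<in> V"
      using psi_continuous_at[OF c V(1,2)] by blast
    have "torsion_part P \<inter> W0 \<noteq> {}"
      using tor dense_intersects_open[of TP "torsion_part P"] topological_group_topspace[OF P] W0(1,2) by auto
    then obtain t where t: "t \<in> torsion_part P" "t \<in> W0" by blast
    obtain W where W: "openin TP W" "t \<in> W" "\<And>w. w \<in> W \<Longrightarrow> w \<in> C \<Longrightarrow> \<psi> w \<in> V"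
      using psi_small_near_torsion[OF tf t(1) V(1,2)] by blast
    obtain h where h: "h \<in> C" "h \<in> W \<inter> W0"
      using meets[of "W \<inter> W0" t] W(1,2) W0(1) t(2) by blast
    \<comment> \<open>The product is just \<open>\<psi> c\<close>, written with two factors from
      \<open>V\<close>.\<close>
    then have "\<psi> h \<otimes>\<^bsub>H\<^esub> inv\<^bsub>H\<^esub> (inv\<^bsub>H\<^esub> (\<psi> c) \<otimes>\<^bsub>H\<^esub> \<psi> h) \<in> U"
      using W(3) W0(3) V(3,4) by auto
    then show ?thesis
      using h(1) c by (simp add: psi_closed H.inv_mult_group flip: H.m_assoc)
  qed
  then show ?thesis using topological_group_separate[OF H psi_closed[OF c]] by blast
qed

end

section \<open>Groups of continuous functions\<close>

lemma carrier_Cp: "f \<in> carrier (Cp_grp X K T) \<longleftrightarrow> continuous_map X T f \<and> f \<in> extensional (topspace X)"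
  and mult_Cp: "f \<otimes>\<^bsub>Cp_grp X K T\<^esub> g = (\<lambda>x\<in>topspace X. f x \<otimes>\<^bsub>K\<^esub> g x)"
  and one_Cp: "\<one>\<^bsub>Cp_grp X K T\<^esub> = (\<lambda>x\<in>topspace X. \<one>\<^bsub>K\<^esub>)"
  by (simp_all add: Cp_grp_def)

lemma restrict_in_Cp: "continuous_map X T f \<Longrightarrow> restrict f (topspace X) \<in> carrier (Cp_grp X K T)"
  by (auto simp: carrier_Cp intro: continuous_map_eq)

lemma topspace_Cp: "topspace (Cp_top X K T) = carrier (Cp_grp X K T)"
  by (auto simp: Cp_top_def carrier_Cp PiE_def intro: Pi_mem[OF continuous_map_funspace])

lemma continuous_map_into_Cp_top:
  "continuous_map Z (Cp_top X K T) F \<longleftrightarrow>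
    F ` topspace Z \<subseteq> carrier (Cp_grp X K T) \<and> (\<forall>x\<in>topspace X. continuous_map Z T (\<lambda>z. F z x))"
  by (auto simp: Cp_top_def continuous_map_in_subtopology continuous_map_componentwise carrier_Cp)

lemma continuous_map_eval_Cp: "x \<in> topspace X \<Longrightarrow> continuous_map (Cp_top X K T) T (\<lambda>f. f x)"
  unfolding Cp_top_def by (intro continuous_map_from_subtopology continuous_map_product_projection)

lemma group_Cp:
  assumes K: "topological_group K T"
  shows "group (Cp_grp X K T)"
proof -
  interpret K: group K by (rule topological_group_group[OF K])
  have pt: "f x \<in> carrier K" if "f \<in> carrier (Cp_grp X K T)" "x \<in> topspace X" for f x
    using that continuous_map_image_subset_topspace[of X T f] topological_group_topspace[OF K]
    by (auto simp: carrier_Cp)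
  have ext: "f \<in> extensional (topspace X)" if "f \<in> carrier (Cp_grp X K T)" for f
    using that by (simp add: carrier_Cp)
  show ?thesis
  proof (rule groupI)
    show "f \<otimes>\<^bsub>Cp_grp X K T\<^esub> g \<in> carrier (Cp_grp X K T)" if "f \<in> carrier (Cp_grp X K T)" "g \<in> carrier (Cp_grp X K T)" for f g
      unfolding mult_Cp using that
      by (intro restrict_in_Cp topological_group_continuous_mult[OF K]) (simp_all add: carrier_Cp)
    show "\<one>\<^bsub>Cp_grp X K T\<^esub> \<in> carrier (Cp_grp X K T)"
      unfolding one_Cp by (intro restrict_in_Cp topological_group_continuous_const[OF K]) simp
    show "f \<otimes>\<^bsub>Cp_grp X K T\<^esub> g \<otimes>\<^bsub>Cp_grp X K T\<^esub> h = f \<otimes>\<^bsub>Cp_grp X K T\<^esub> (g \<otimes>\<^bsub>Cp_grp X K T\<^esub> h)"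
      if "f \<in> carrier (Cp_grp X K T)" "g \<in> carrier (Cp_grp X K T)" "h \<in> carrier (Cp_grp X K T)" for f g h
      using that by (auto simp: mult_Cp fun_eq_iff pt K.m_assoc)
    show "\<one>\<^bsub>Cp_grp X K T\<^esub> \<otimes>\<^bsub>Cp_grp X K T\<^esub> f = f" if "f \<in> carrier (Cp_grp X K T)" for f
      using that ext[OF that] by (auto simp: mult_Cp one_Cp fun_eq_iff pt extensional_def)
    show "\<exists>g\<in>carrier (Cp_grp X K T). g \<otimes>\<^bsub>Cp_grp X K T\<^esub> f = \<one>\<^bsub>Cp_grp X K T\<^esub>" if "f \<in> carrier (Cp_grp X K T)" for f
    proof
      show "(\<lambda>x\<in>topspace X. inv\<^bsub>K\<^esub> (f x)) \<in> carrier (Cp_grp X K T)"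
        using that by (intro restrict_in_Cp topological_group_continuous_inv[OF K]) (simp add: carrier_Cp)
      show "(\<lambda>x\<in>topspace X. inv\<^bsub>K\<^esub> (f x)) \<otimes>\<^bsub>Cp_grp X K T\<^esub> f = \<one>\<^bsub>Cp_grp X K T\<^esub>"
        using that by (auto simp: mult_Cp one_Cp fun_eq_iff pt)
    qed
  qed
qed

context
  fixes K :: "('k, 'm) monoid_scheme" and T :: "'k topology"
  assumes K: "topological_group K T"
begin

interpretation K: group K by (rule topological_group_group[OF K])

lemma Cp_apply_closed: "f \<in> carrier (Cp_grp X K T) \<Longrightarrow> x \<in> topspace X \<Longrightarrow> f x \<in> carrier K"
  using continuous_map_image_subset_topspace[of X T f] topological_group_topspace[OF K]
  by (auto simp: carrier_Cp)

lemma inv_Cp: 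
  assumes "f \<in> carrier (Cp_grp X K T)"
  shows "inv\<^bsub>Cp_grp X K T\<^esub> f = (\<lambda>x\<in>topspace X. inv\<^bsub>K\<^esub> (f x))"
proof (rule group.inv_equality[OF group_Cp[OF K]])
  show "(\<lambda>x\<in>topspace X. inv\<^bsub>K\<^esub> (f x)) \<otimes>\<^bsub>Cp_grp X K T\<^esub> f = \<one>\<^bsub>Cp_grp X K T\<^esub>"
    using assms by (auto simp: mult_Cp one_Cp fun_eq_iff Cp_apply_closed)
  show "(\<lambda>x\<in>topspace X. inv\<^bsub>K\<^esub> (f x)) \<in> carrier (Cp_grp X K T)"
    using assms by (intro restrict_in_Cp topological_group_continuous_inv[OF K]) (simp add: carrier_Cp)
qed fact

lemma pow_Cp: "f \<in> carrier (Cp_grp X K T) \<Longrightarrow> f [^]\<^bsub>Cp_grp X K T\<^esub> (n::nat) = (\<lambda>x\<in>topspace X. f x [^]\<^bsub>K\<^esub> n)"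
  by (induction n) (auto simp: one_Cp mult_Cp fun_eq_iff)

lemma topological_group_Cp: "topological_group (Cp_grp X K T) (Cp_top X K T)"
  unfolding topological_group_def
proof (intro conjI)
  let ?P = "prod_topology (Cp_top X K T) (Cp_top X K T)"
  interpret Cp: group "Cp_grp X K T" by (rule group_Cp[OF K])
  show "group (Cp_grp X K T)" by (rule group_Cp[OF K])
  show "topspace (Cp_top X K T) = carrier (Cp_grp X K T)" by (rule topspace_Cp)
  show "Hausdorff_space (Cp_top X K T)"
    unfolding Cp_top_def
    by (intro Hausdorff_space_subtopology) (simp add: Hausdorff_space_product_topology topological_group_Hausdorff[OF K])
  show "continuous_map ?P (Cp_top X K T) (\<lambda>(f, g). f \<otimes>\<^bsub>Cp_grp X K T\<^esub> g)"
    unfolding continuous_map_into_Cp_top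
  proof (intro conjI ballI)
    show "(\<lambda>(f, g). f \<otimes>\<^bsub>Cp_grp X K T\<^esub> g) ` topspace ?P \<subseteq> carrier (Cp_grp X K T)"
      by (auto simp: topspace_Cp)
    fix x assume x: "x \<in> topspace X"
    have "continuous_map ?P T (\<lambda>z. fst z x)" "continuous_map ?P T (\<lambda>z. snd z x)"
      using continuous_map_compose[OF continuous_map_fst continuous_map_eval_Cp[OF x]]
        continuous_map_compose[OF continuous_map_snd continuous_map_eval_Cp[OF x]] by (simp_all add: o_def)
    from topological_group_continuous_mult[OF K this]
    show "continuous_map ?P T (\<lambda>z. (case z of (f, g) \<Rightarrow> f \<otimes>\<^bsub>Cp_grp X K T\<^esub> g) x)"
      by (simp add: mult_Cp case_prod_beta x)
  qed
  show "continuous_map (Cp_top X K T) (Cp_top X K T) (\<lambda>f. inv\<^bsub>Cp_grp X K T\<^esub> f)"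
    unfolding continuous_map_into_Cp_top
  proof (intro conjI ballI)
    show "(\<lambda>f. inv\<^bsub>Cp_grp X K T\<^esub> f) ` topspace (Cp_top X K T) \<subseteq> carrier (Cp_grp X K T)"
      by (auto simp: topspace_Cp)
    fix x assume x: "x \<in> topspace X"
    show "continuous_map (Cp_top X K T) T (\<lambda>f. (inv\<^bsub>Cp_grp X K T\<^esub> f) x)"
      by (rule continuous_map_eq[OF topological_group_continuous_inv[OF K continuous_map_eval_Cp[OF x, of K T]]])
        (simp add: topspace_Cp inv_Cp x)
  qed
qed

text \<open>The power \<open>K\<^sup>S\<close> is modelled as the function group over the discrete space \<open>S\<close>.\<close>

lemma carrier_Cp_discrete: "carrier (Cp_grp (discrete_topology S) K T) = (\<Pi>\<^sub>E x\<in>S. carrier K)"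
  by (auto simp: carrier_Cp PiE_def topological_group_topspace[OF K])

lemma Cp_top_discrete: "Cp_top (discrete_topology S) K T = product_topology (\<lambda>_. T) S"
proof -
  have "(\<Pi>\<^sub>E x\<in>S. carrier K) = topspace (product_topology (\<lambda>_. T) S)"
    by (simp add: topological_group_topspace[OF K])
  then show ?thesis
    unfolding Cp_top_def carrier_Cp_discrete by (simp only: topspace_discrete_topology subtopology_topspace)
qed

text \<open>Both groups use the same pointwise operations on functions extensional on
  \<open>topspace X\<close>, so it suffices that the smaller carrier is a group under them.\<close>

lemma subgroup_Cp_discrete: "subgroup (carrier (Cp_grp X K T)) (Cp_grp (discrete_topology (topspace X)) K T)"
proof (rule group.group_incl_imp_subgroup[OF group_Cp[OF K]])
  show "carrier (Cp_grp X K T) \<subseteq> carrier (Cp_grp (discrete_topology (topspace X)) K T)"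
    unfolding carrier_Cp_discrete
  proof
    fix f assume f: "f \<in> carrier (Cp_grp X K T)"
    then show "f \<in> (\<Pi>\<^sub>E x\<in>topspace X. carrier K)"
      using Cp_apply_closed[OF f] by (simp add: PiE_iff carrier_Cp)
  qed
  show "group (Cp_grp (discrete_topology (topspace X)) K T\<lparr>carrier := carrier (Cp_grp X K T)\<rparr>)"
    using group_Cp[OF K, of X] by (simp add: Cp_grp_def)
qed

section \<open>Dense subsets of a power of the group\<close>

text \<open>On a discrete space any choice of \<open>n\<close>-th roots in the coordinates is
  continuous, so roots can be taken coordinate by coordinate; over a general \<open>X\<close> such a
  choice may fail to be continuous.\<close>

lemma power_set_Cp_discrete:
  "power_set_grp (Cp_grp (discrete_topology S) K T) n = (\<Pi>\<^sub>E x\<in>S. power_set_grp K n)"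
proof -
  let ?D = "Cp_grp (discrete_topology S) K T"
  have pow: "f [^]\<^bsub>?D\<^esub> n = (\<lambda>x\<in>S. f x [^]\<^bsub>K\<^esub> n)" if "f \<in> carrier ?D" for f
    using pow_Cp[OF that] by simp
  show ?thesis
  proof (intro equalityI subsetI)
    fix f assume "f \<in> power_set_grp ?D n"
    then obtain h where h: "h \<in> carrier ?D" "f = (\<lambda>x\<in>S. h x [^]\<^bsub>K\<^esub> n)"
      by (auto simp: power_set_grp_def pow)
    then have "h x \<in> carrier K" if "x \<in> S" for x using that by (auto simp: carrier_Cp_discrete)
    with h(2) show "f \<in> (\<Pi>\<^sub>E x\<in>S. power_set_grp K n)"
      by (auto simp: power_set_grp_def)
  next
    fix f assume f: "f \<in> (\<Pi>\<^sub>E x\<in>S. power_set_grp K n)"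
    then have "\<forall>x\<in>S. \<exists>k. k \<in> carrier K \<and> f x = k [^]\<^bsub>K\<^esub> n" by (auto simp: power_set_grp_def PiE_iff)
    then obtain h where h: "\<forall>x\<in>S. h x \<in> carrier K \<and> f x = h x [^]\<^bsub>K\<^esub> n" by metis
    then have h': "restrict h S \<in> carrier ?D" by (simp add: carrier_Cp_discrete)
    have "f = restrict h S [^]\<^bsub>?D\<^esub> n"
      unfolding pow[OF h'] using f h by (auto simp: fun_eq_iff PiE_iff extensional_def)
    with h' show "f \<in> power_set_grp ?D n" by (auto simp: power_set_grp_def)
  qed
qed

lemma dense_powers_Cp_discrete:
  assumes "T closure_of (power_set_grp K n) = carrier K"
  shows "Cp_top (discrete_topology S) K T closure_of power_set_grp (Cp_grp (discrete_topology S) K T) n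
    = carrier (Cp_grp (discrete_topology S) K T)"
  using assms by (simp add: Cp_top_discrete power_set_Cp_discrete closure_of_product_topology carrier_Cp_discrete)

text \<open>A basic open box constrains finitely many coordinates, which turns density into a finite
  approximation problem. It is used for the torsion elements and for
  \<open>C_p(X,K)\<close>.\<close>

lemma dense_in_Cp_discreteI:
  assumes "\<And>I U. finite I \<Longrightarrow> I \<subseteq> S \<Longrightarrow> (\<And>x. x \<in> I \<Longrightarrow> openin T (U x) \<and> U x \<noteq> {}) \<Longrightarrow>
      \<exists>f\<in>A. f \<in> (\<Pi>\<^sub>E x\<in>S. carrier K) \<and> (\<forall>x\<in>I. f x \<in> U x)"
  shows "Cp_top (discrete_topology S) K T closure_of A = carrier (Cp_grp (discrete_topology S) K T)"
proof -
  let ?P = "Cp_top (discrete_topology S) K T"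
  have "A \<inter> W \<noteq> {}" if W: "openin ?P W" "W \<noteq> {}" for W
  proof -
    from W(2) obtain w where w: "w \<in> W" by blast
    obtain U where U: "finite {x \<in> S. U x \<noteq> carrier K}" "\<forall>x\<in>S. openin T (U x)" "w \<in> Pi\<^sub>E S U" "Pi\<^sub>E S U \<subseteq> W"
      using W(1) w unfolding Cp_top_discrete openin_product_topology_alt topological_group_topspace[OF K] by meson
    have "openin T (U x) \<and> U x \<noteq> {}" if "x \<in> {x \<in> S. U x \<noteq> carrier K}" for x
      using that U(2,3) by auto
    from assms[of "{x \<in> S. U x \<noteq> carrier K}" U, OF U(1) _ this] obtain f where f: "f \<in> A" "f \<in> (\<Pi>\<^sub>E x\<in>S. carrier K)"
      "\<forall>x\<in>{x \<in> S. U x \<noteq> carrier K}. f x \<in> U x" by blast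
    have "f x \<in> U x" if "x \<in> S" for x
      using f(2,3) that by (cases "U x = carrier K") auto
    then have "f \<in> Pi\<^sub>E S U" using f(2) by (auto simp: PiE_iff)
    with f(1) U(4) show ?thesis by blast
  qed
  then show ?thesis using dense_intersects_open[of ?P A] by (metis topspace_Cp)
qed

text \<open>Coordinatewise torsion is not enough, as the orders may be unbounded. Approximants equal
  to one outside a finite set of coordinates have a common exponent.\<close>

lemma dense_torsion_Cp_discrete:
  assumes tor: "T closure_of (torsion_part K) = carrier K"
  shows "Cp_top (discrete_topology S) K T closure_of torsion_part (Cp_grp (discrete_topology S) K T)
    = carrier (Cp_grp (discrete_topology S) K T)"
proof (rule dense_in_Cp_discreteI)
  let ?D = "Cp_grp (discrete_topology S) K T"
  fix I U assume I: "finite I" "I \<subseteq> S" and U: "\<And>x. x \<in> I \<Longrightarrow> openin T (U x) \<and> U x \<noteq> {}"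
  have "\<exists>t m. t \<in> carrier K \<and> m \<ge> (1::nat) \<and> t [^]\<^bsub>K\<^esub> m = \<one>\<^bsub>K\<^esub> \<and> t \<in> U x" if "x \<in> I" for x
  proof -
    have "torsion_part K \<inter> U x \<noteq> {}"
      using dense_intersects_open[of T "torsion_part K"] tor U[OF that] topological_group_topspace[OF K] by metis
    then show ?thesis by (auto simp: torsion_part_def)
  qed
  then obtain t m where t: "\<And>x. x \<in> I \<Longrightarrow> t x \<in> carrier K \<and> m x \<ge> (1::nat) \<and> t x [^]\<^bsub>K\<^esub> m x = \<one>\<^bsub>K\<^esub> \<and> t x \<in> U x"
    by metis
  define f where "f = (\<lambda>x\<in>S. if x \<in> I then t x else \<one>\<^bsub>K\<^esub>)"
  \<comment> \<open>Each exponent \<open>m x\<close> with \<open>x\<close> in \<open>I\<close>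
    divides this product.\<close>
  define M where "M = prod m I"
  have fD: "f \<in> carrier ?D" using t by (auto simp: f_def carrier_Cp_discrete)
  have "f x [^]\<^bsub>K\<^esub> M = \<one>\<^bsub>K\<^esub>" if "x \<in> S" for x
  proof (cases "x \<in> I")
    case True
    then obtain k where "M = m x * k" using I(1) dvd_prodI[of I x m] by (auto simp: M_def elim: dvdE)
    then show ?thesis using t[OF True] True that by (simp add: f_def flip: K.nat_pow_pow)
  qed (use that in \<open>simp add: f_def\<close>)
  then have "f [^]\<^bsub>?D\<^esub> M = \<one>\<^bsub>?D\<^esub>"
    using pow_Cp[OF fD, of M] by (auto simp: one_Cp fun_eq_iff)
  moreover have "M \<ge> 1" using t unfolding M_def by (intro prod_ge_1) simp
  ultimately have "f \<in> torsion_part ?D" using fD by (auto simp: torsion_part_def)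
  moreover have "f \<in> (\<Pi>\<^sub>E x\<in>S. carrier K)" "\<forall>x\<in>I. f x \<in> U x"
    using fD t I(2) by (auto simp: f_def carrier_Cp_discrete)
  ultimately show "\<exists>f\<in>torsion_part ?D. f \<in> (\<Pi>\<^sub>E x\<in>S. carrier K) \<and> (\<forall>x\<in>I. f x \<in> U x)" by blast
qed

text \<open>Induction on the points: a function correct on \<open>I\<close> is multiplied by one
  that is the identity on \<open>I\<close>, a closed set since it is finite, and supplies the
  missing factor at the new point.\<close>

lemma Gss_regular_interpolation:
  assumes X: "Hausdorff_space X" and reg: "Gss_regular X K T"
    and "finite I" "I \<subseteq> topspace X" "\<And>x. x \<in> I \<Longrightarrow> v x \<in> carrier K"
  shows "\<exists>f\<in>carrier (Cp_grp X K T). \<forall>x\<in>I. f x = v x"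
  using assms(3-)
proof (induction I rule: finite_induct)
  case empty
  show ?case using group.is_monoid[OF group_Cp[OF K]] monoid.one_closed by fastforce
next
  case (insert a I)
  interpret Cp: group "Cp_grp X K T" by (rule group_Cp[OF K])
  obtain f where f: "f \<in> carrier (Cp_grp X K T)" "\<forall>x\<in>I. f x = v x"
    using insert by auto
  have fa: "f a \<in> carrier K" using Cp_apply_closed[OF f(1)] insert by auto
  have "closedin X I" using closedin_Hausdorff_finite[OF X] insert by auto
  \<comment> \<open>The prescribed value at \<open>a\<close> solves \<open>f a * g a = v a\<close>;
    the factor stands on the right because \<open>K\<close> may be noncommutative.\<close>
  then obtain g where g: "continuous_map X T g" "g a = inv\<^bsub>K\<^esub> (f a) \<otimes>\<^bsub>K\<^esub> v a" "g ` I \<subseteq> {\<one>\<^bsub>K\<^esub>}"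
    using reg fa insert unfolding Gss_regular_def
    by (metis DiffI K.inv_closed K.m_closed insertCI insert_subset)
  let ?h = "f \<otimes>\<^bsub>Cp_grp X K T\<^esub> restrict g (topspace X)"
  have "?h \<in> carrier (Cp_grp X K T)" using f g restrict_in_Cp by blast
  moreover have "?h x = v x" if "x \<in> insert a I" for x
  proof (cases "x = a")
    case True
    then show ?thesis using insert.prems fa g(2) by (simp add: mult_Cp flip: K.m_assoc)
  next
    case False
    then have "x \<in> I" "g x = \<one>\<^bsub>K\<^esub>" using that g(3) by auto
    then show ?thesis using insert.prems f(2) by (auto simp: mult_Cp)
  qed
  ultimately show ?case by blast
qed

lemma dense_Cp:
  assumes X: "Hausdorff_space X" and reg: "Gss_regular X K T"
  shows "Cp_top (discrete_topology (topspace X)) K T closure_of carrier (Cp_grp X K T)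
    = carrier (Cp_grp (discrete_topology (topspace X)) K T)"
proof (rule dense_in_Cp_discreteI)
  fix I U assume I: "finite I" "I \<subseteq> topspace X" and U: "\<And>x. x \<in> I \<Longrightarrow> openin T (U x) \<and> U x \<noteq> {}"
  define v where "v x = (SOME y. y \<in> U x)" for x
  have v: "v x \<in> U x" if "x \<in> I" for x
    unfolding v_def using U[OF that] by (simp add: some_in_eq)
  have "v x \<in> carrier K" if "x \<in> I" for x
    using v[OF that] U[OF that] openin_subset[of T "U x"] topological_group_topspace[OF K] by auto
  then obtain f where f: "f \<in> carrier (Cp_grp X K T)" "\<forall>x\<in>I. f x = v x"
    using Gss_regular_interpolation[OF X reg I] by blast
  have "f \<in> (\<Pi>\<^sub>E x\<in>topspace X. carrier K)"
    using Cp_apply_closed[OF f(1)] f(1) by (simp add: PiE_iff carrier_Cp)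
  then show "\<exists>f\<in>carrier (Cp_grp X K T). f \<in> (\<Pi>\<^sub>E x\<in>topspace X. carrier K) \<and> (\<forall>x\<in>I. f x \<in> U x)"
    using f v by auto
qed

end

section \<open>Homomorphisms from functions into G to the group H\<close>

lemma Cp_hom_trivial:
  assumes G: "topological_group G TG" and H: "topological_group H TH"
    and cond: "(TG closure_of (torsion_part G) = carrier G \<and> torsion_free (completion_grp H TH))
         \<or> (\<exists>n::nat. power_set_grp (completion_grp G TG) n = carrier (completion_grp G TG)
                    \<and> power_set_grp H n = {\<one>\<^bsub>H\<^esub>})"
    and X: "Hausdorff_space X" "Gss_regular X G TG"
    and \<psi>: "\<psi> \<in> hom (Cp_grp X G TG) H" "continuous_map (Cp_top X G TG) TH \<psi>"
    and f: "f \<in> carrier (Cp_grp X G TG)"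
  shows "\<psi> f = \<one>\<^bsub>H\<^esub>"
proof -
  let ?S = "topspace X"
  let ?P = "Cp_grp (discrete_topology ?S) G TG" and ?TP = "Cp_top (discrete_topology ?S) G TG"
  let ?C = "carrier (Cp_grp X G TG)"
  \<comment> \<open>The operations and the topology of \<open>C_p(X,G)\<close> are those induced
    from \<open>G^X\<close>, so \<open>\<psi>\<close> is a homomorphism on a dense subgroup of the
    power.\<close>
  have CP: "?P\<lparr>carrier := ?C\<rparr> = Cp_grp X G TG" by (simp add: Cp_grp_def)
  have "subtopology ?TP ?C = Cp_top X G TG"
    unfolding Cp_top_discrete[OF G] by (simp add: Cp_top_def)
  then interpret dense_subgroup_hom ?P ?TP ?C H TH \<psi>
    by (intro dense_subgroup_hom.intro)
      (simp_all add: CP \<psi> topological_group_Cp[OF G] H subgroup_Cp_discrete[OF G] dense_Cp[OF G X])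
  from cond show ?thesis
    using hom_trivial_torsion[OF dense_torsion_Cp_discrete[OF G] _ f]
      hom_trivial_divisible[OF dense_powers_Cp_discrete[OF G dense_powers_of_completion_powers[OF G]] _ f]
    by blast
qed

section \<open>Products of topological groups\<close>

text \<open>An explicit inverse puts both directions on an equal footing, so that components of
  \<open>f\<close> and \<open>g\<close> can be extracted and composed.\<close>

lemma top_group_isomorphic_iff:
  assumes "topological_group A TA" "topological_group B TB"
  shows "top_group_isomorphic A TA B TB \<longleftrightarrow>
    (\<exists>f g. group_isomorphisms A B f g \<and> continuous_map TA TB f \<and> continuous_map TB TA g)"
proof
  interpret A: group A by (rule topological_group_group[OF assms(1)])
  note top = topological_group_topspace[OF assms(1)] topological_group_topspace[OF assms(2)]
  assume "top_group_isomorphic A TA B TB"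
  then obtain f g where f: "f \<in> iso A B" and g: "homeomorphic_maps TA TB f g"
    by (auto simp: top_group_isomorphic_def homeomorphic_map_maps)
  \<comment> \<open>The inverse from the homeomorphism is continuous and the one from the group
    isomorphism is a homomorphism; agreeing on the carrier, they give one map with both
    properties.\<close>
  have inv: "inv_into (carrier A) f b = g b" if "b \<in> carrier B" for b
  proof -
    have "continuous_map TB TA g" "f (g b) = b" using g that by (auto simp: homeomorphic_maps_def top)
    moreover from this have "g b \<in> carrier A"
      using that Pi_mem[OF continuous_map_funspace[OF \<open>continuous_map TB TA g\<close>], of b] by (simp add: top)
    moreover have "inj_on f (carrier A)" using f by (simp add: iso_def bij_betw_def)
    ultimately show ?thesis using inv_into_f_f by metis
  qed
  have "inv_into (carrier A) f \<in> hom B A" using A.iso_set_sym[OF f] by (simp add: iso_def)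
  then have "g \<in> hom B A"
    by (rule group.hom_restrict[OF topological_group_group[OF assms(2)]]) (rule inv)
  then show "\<exists>f g. group_isomorphisms A B f g \<and> continuous_map TA TB f \<and> continuous_map TB TA g"
    using f g by (auto simp: group_isomorphisms_def iso_def homeomorphic_maps_def top)
next
  interpret A: group A by (rule topological_group_group[OF assms(1)])
  note top = topological_group_topspace[OF assms(1)] topological_group_topspace[OF assms(2)]
  assume "\<exists>f g. group_isomorphisms A B f g \<and> continuous_map TA TB f \<and> continuous_map TB TA g"
  then obtain f g where fg: "group_isomorphisms A B f g" "continuous_map TA TB f" "continuous_map TB TA g" by blast
  then have "homeomorphic_maps TA TB f g"
    by (auto simp: homeomorphic_maps_def group_isomorphisms_def top)
  moreover have "f \<in> iso A B"
    using A.iso_iff_group_isomorphisms fg(1) by blast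
  ultimately show "top_group_isomorphic A TA B TB"
    by (auto simp: top_group_isomorphic_def homeomorphic_map_maps)
qed

lemma top_group_isomorphic_sym:
  assumes "topological_group A TA" "topological_group B TB" "top_group_isomorphic A TA B TB"
  shows "top_group_isomorphic B TB A TA"
  using assms(3) unfolding top_group_isomorphic_iff[OF assms(1,2)] top_group_isomorphic_iff[OF assms(2,1)]
  by (auto simp: group_isomorphisms_def)

lemma top_group_isomorphic_trans:
  "top_group_isomorphic A TA B TB \<Longrightarrow> top_group_isomorphic B TB C TC \<Longrightarrow> top_group_isomorphic A TA C TC"
  unfolding top_group_isomorphic_def using iso_set_trans homeomorphic_map_compose by blast

lemma topological_group_DirProd:
  assumes A: "topological_group A TA" and B: "topological_group B TB"
  shows "topological_group (A \<times>\<times> B) (prod_topology TA TB)"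
  unfolding topological_group_def
proof (intro conjI)
  interpret A: group A by (rule topological_group_group[OF A])
  interpret B: group B by (rule topological_group_group[OF B])
  let ?T = "prod_topology TA TB"
  show "group (A \<times>\<times> B)" by (intro DirProd_group A.is_group B.is_group)
  show top: "topspace ?T = carrier (A \<times>\<times> B)"
    by (simp add: topological_group_topspace[OF A] topological_group_topspace[OF B])
  show "Hausdorff_space ?T"
    by (simp add: Hausdorff_space_prod_topology topological_group_Hausdorff[OF A] topological_group_Hausdorff[OF B])
  have "continuous_map (prod_topology ?T ?T) ?T
      (\<lambda>z. (fst (fst z) \<otimes>\<^bsub>A\<^esub> fst (snd z), snd (fst z) \<otimes>\<^bsub>B\<^esub> snd (snd z)))"
    using continuous_map_compose[OF continuous_map_fst continuous_map_fst]
      continuous_map_compose[OF continuous_map_fst continuous_map_snd]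
      continuous_map_compose[OF continuous_map_snd continuous_map_fst]
      continuous_map_compose[OF continuous_map_snd continuous_map_snd]
    by (intro continuous_map_pairedI topological_group_continuous_mult[OF A] topological_group_continuous_mult[OF B])
      (simp_all add: o_def)
  then show "continuous_map (prod_topology ?T ?T) ?T (\<lambda>(x, y). x \<otimes>\<^bsub>A \<times>\<times> B\<^esub> y)"
    by (simp add: mult_DirProd' case_prod_unfold)
  have "continuous_map ?T ?T (\<lambda>z. (inv\<^bsub>A\<^esub> (fst z), inv\<^bsub>B\<^esub> (snd z)))"
    by (intro continuous_map_pairedI topological_group_continuous_inv[OF A] topological_group_continuous_inv[OF B]
        continuous_map_fst continuous_map_snd)
  then show "continuous_map ?T ?T (\<lambda>x. inv\<^bsub>A \<times>\<times> B\<^esub> x)"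
    by (rule continuous_map_eq)
      (auto simp: topological_group_topspace[OF A] topological_group_topspace[OF B] inv_DirProd A.is_group B.is_group)
qed

section \<open>Triangular isomorphisms of products\<close>

text \<open>Both \<open>f\<close> and \<open>g\<close> preserve the first factor, so their
  restrictions to it are mutually inverse. On the second factor \<open>f\<close> may leave a
  component in \<open>A'\<close>, so only the induced maps modulo the first factors are inverse to
  each other.\<close>

lemma DirProd_isomorphic_factors:
  assumes tg: "topological_group A TA" "topological_group B TB" "topological_group A' TA'" "topological_group B' TB'"
    and iso: "group_isomorphisms (A \<times>\<times> B) (A' \<times>\<times> B') f g"
    and cf: "continuous_map (prod_topology TA TB) (prod_topology TA' TB') f"
    and cg: "continuous_map (prod_topology TA' TB') (prod_topology TA TB) g"
    and f1: "\<And>a. a \<in> carrier A \<Longrightarrow> snd (f (a, \<one>\<^bsub>B\<^esub>)) = \<one>\<^bsub>B'\<^esub>"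
    and g1: "\<And>a. a \<in> carrier A' \<Longrightarrow> snd (g (a, \<one>\<^bsub>B'\<^esub>)) = \<one>\<^bsub>B\<^esub>"
  shows "top_group_isomorphic A TA A' TA'" "top_group_isomorphic B TB B' TB'"
proof -
  interpret A: group A by (rule topological_group_group[OF tg(1)])
  interpret B: group B by (rule topological_group_group[OF tg(2)])
  interpret A': group A' by (rule topological_group_group[OF tg(3)])
  interpret B': group B' by (rule topological_group_group[OF tg(4)])
  have f: "f \<in> hom (A \<times>\<times> B) (A' \<times>\<times> B')" and g: "g \<in> hom (A' \<times>\<times> B') (A \<times>\<times> B)"
    and gf: "\<And>x. x \<in> carrier A \<times> carrier B \<Longrightarrow> g (f x) = x"
    and fg: "\<And>x. x \<in> carrier A' \<times> carrier B' \<Longrightarrow> f (g x) = x"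
    using iso by (auto simp: group_isomorphisms_def)
  have f_in: "f x \<in> carrier A' \<times> carrier B'" if "x \<in> carrier A \<times> carrier B" for x
    using hom_in_carrier[OF f] that by simp
  have g_in: "g x \<in> carrier A \<times> carrier B" if "x \<in> carrier A' \<times> carrier B'" for x
    using hom_in_carrier[OF g] that by simp
  have inl: "(\<lambda>a. (a, \<one>\<^bsub>B\<^esub>)) \<in> hom A (A \<times>\<times> B)" "(\<lambda>a. (a, \<one>\<^bsub>B'\<^esub>)) \<in> hom A' (A' \<times>\<times> B')"
    and inr: "(\<lambda>b. (\<one>\<^bsub>A\<^esub>, b)) \<in> hom B (A \<times>\<times> B)" "(\<lambda>b. (\<one>\<^bsub>A'\<^esub>, b)) \<in> hom B' (A' \<times>\<times> B')"
    by (auto simp: hom_def)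
  have pr: "fst \<in> hom (M \<times>\<times> N) M" "snd \<in> hom (M \<times>\<times> N) N" for M :: "('r, 'u) monoid_scheme" and N :: "('s, 'v) monoid_scheme"
    by (auto simp: hom_def)
  have cl: "continuous_map TA (prod_topology TA TB) (\<lambda>a. (a, \<one>\<^bsub>B\<^esub>))"
    "continuous_map TA' (prod_topology TA' TB') (\<lambda>a. (a, \<one>\<^bsub>B'\<^esub>))"
    "continuous_map TB (prod_topology TA TB) (\<lambda>b. (\<one>\<^bsub>A\<^esub>, b))"
    "continuous_map TB' (prod_topology TA' TB') (\<lambda>b. (\<one>\<^bsub>A'\<^esub>, b))"
    using tg[THEN topological_group_topspace] by (simp_all add: continuous_map_paired continuous_map_id[unfolded id_def])
  show "top_group_isomorphic A TA A' TA'"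
    unfolding top_group_isomorphic_iff[OF tg(1,3)] group_isomorphisms_def
  proof (intro exI[of _ "fst \<circ> (f \<circ> (\<lambda>a. (a, \<one>\<^bsub>B\<^esub>)))"] exI[of _ "fst \<circ> (g \<circ> (\<lambda>a. (a, \<one>\<^bsub>B'\<^esub>)))"] conjI ballI)
    show "fst \<circ> (f \<circ> (\<lambda>a. (a, \<one>\<^bsub>B\<^esub>))) \<in> hom A A'" "fst \<circ> (g \<circ> (\<lambda>a. (a, \<one>\<^bsub>B'\<^esub>))) \<in> hom A' A"
      by (rule hom_compose[OF hom_compose[OF _ f] pr(1)] hom_compose[OF hom_compose[OF _ g] pr(1)], rule inl)+
    show "continuous_map TA TA' (fst \<circ> (f \<circ> (\<lambda>a. (a, \<one>\<^bsub>B\<^esub>))))" "continuous_map TA' TA (fst \<circ> (g \<circ> (\<lambda>a. (a, \<one>\<^bsub>B'\<^esub>))))"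
      by (rule continuous_map_compose[OF continuous_map_compose[OF cl(1) cf] continuous_map_fst]
          continuous_map_compose[OF continuous_map_compose[OF cl(2) cg] continuous_map_fst])+
    fix a assume a: "a \<in> carrier A"
    then have "f (a, \<one>\<^bsub>B\<^esub>) = (fst (f (a, \<one>\<^bsub>B\<^esub>)), \<one>\<^bsub>B'\<^esub>)" using f1[OF a] by (metis prod.collapse)
    then show "(fst \<circ> (g \<circ> (\<lambda>a. (a, \<one>\<^bsub>B'\<^esub>)))) ((fst \<circ> (f \<circ> (\<lambda>a. (a, \<one>\<^bsub>B\<^esub>)))) a) = a"
      using gf[of "(a, \<one>\<^bsub>B\<^esub>)"] a by simp
  next
    fix a assume a: "a \<in> carrier A'"
    then have "g (a, \<one>\<^bsub>B'\<^esub>) = (fst (g (a, \<one>\<^bsub>B'\<^esub>)), \<one>\<^bsub>B\<^esub>)" using g1[OF a] by (metis prod.collapse)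
    then show "(fst \<circ> (f \<circ> (\<lambda>a. (a, \<one>\<^bsub>B\<^esub>)))) ((fst \<circ> (g \<circ> (\<lambda>a. (a, \<one>\<^bsub>B'\<^esub>)))) a) = a"
      using fg[of "(a, \<one>\<^bsub>B'\<^esub>)"] a by simp
  qed
  \<comment> \<open>Dropping the first component of \<open>h (1, b)\<close> before applying
    \<open>k\<close> leaves the second component of the result unchanged. Stated for generic groups
    because it is used in both directions.\<close>
  have quotient_inverse: "snd (k (\<one>\<^bsub>M'\<^esub>, snd (h (\<one>\<^bsub>M\<^esub>, b)))) = b"
    if "group M" "group N" "group M'" "group N'"
      and k: "k \<in> hom (M' \<times>\<times> N') (M \<times>\<times> N)" and h: "h (\<one>\<^bsub>M\<^esub>, b) \<in> carrier M' \<times> carrier N'"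
      and kh: "k (h (\<one>\<^bsub>M\<^esub>, b)) = (\<one>\<^bsub>M\<^esub>, b)"
      and k1: "\<And>a. a \<in> carrier M' \<Longrightarrow> snd (k (a, \<one>\<^bsub>N'\<^esub>)) = \<one>\<^bsub>N\<^esub>"
    for M :: "('r, 'u) monoid_scheme" and N :: "('s, 'v) monoid_scheme"
      and M' :: "('r2, 'u2) monoid_scheme" and N' :: "('s2, 'v2) monoid_scheme" and h k b
  proof -
    interpret M: group M by fact
    interpret N: group N by fact
    interpret M': group M' by fact
    interpret N': group N' by fact
    obtain a c where ac: "h (\<one>\<^bsub>M\<^esub>, b) = (a, c)" by (cases "h (\<one>\<^bsub>M\<^esub>, b)")
    then have in': "a \<in> carrier M'" "c \<in> carrier N'" using h by auto
    \<comment> \<open>Splitting off \<open>(a, 1)\<close> isolates the discarded part; by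
      \<open>k1\<close> its image has trivial second component.\<close>
    have "k (a, c) = k ((a, \<one>\<^bsub>N'\<^esub>) \<otimes>\<^bsub>M' \<times>\<times> N'\<^esub> (\<one>\<^bsub>M'\<^esub>, c))" using in' by simp
    also have "\<dots> = k (a, \<one>\<^bsub>N'\<^esub>) \<otimes>\<^bsub>M \<times>\<times> N\<^esub> k (\<one>\<^bsub>M'\<^esub>, c)"
      using in' by (intro hom_mult[OF k]) auto
    finally have "snd (k (a, c)) = snd (k (a, \<one>\<^bsub>N'\<^esub>)) \<otimes>\<^bsub>N\<^esub> snd (k (\<one>\<^bsub>M'\<^esub>, c))"
      by (simp add: mult_DirProd')
    moreover have "snd (k (\<one>\<^bsub>M'\<^esub>, c)) \<in> carrier N"
      using hom_in_carrier[OF k, of "(\<one>\<^bsub>M'\<^esub>, c)"] in' by auto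
    ultimately show ?thesis using k1[OF in'(1)] kh ac by simp
  qed
  show "top_group_isomorphic B TB B' TB'"
    unfolding top_group_isomorphic_iff[OF tg(2,4)] group_isomorphisms_def
  proof (intro exI[of _ "snd \<circ> (f \<circ> (\<lambda>b. (\<one>\<^bsub>A\<^esub>, b)))"] exI[of _ "snd \<circ> (g \<circ> (\<lambda>b. (\<one>\<^bsub>A'\<^esub>, b)))"] conjI ballI)
    show "snd \<circ> (f \<circ> (\<lambda>b. (\<one>\<^bsub>A\<^esub>, b))) \<in> hom B B'" "snd \<circ> (g \<circ> (\<lambda>b. (\<one>\<^bsub>A'\<^esub>, b))) \<in> hom B' B"
      by (rule hom_compose[OF hom_compose[OF _ f] pr(2)] hom_compose[OF hom_compose[OF _ g] pr(2)], rule inr)+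
    show "continuous_map TB TB' (snd \<circ> (f \<circ> (\<lambda>b. (\<one>\<^bsub>A\<^esub>, b))))" "continuous_map TB' TB (snd \<circ> (g \<circ> (\<lambda>b. (\<one>\<^bsub>A'\<^esub>, b))))"
      by (rule continuous_map_compose[OF continuous_map_compose[OF cl(3) cf] continuous_map_snd]
          continuous_map_compose[OF continuous_map_compose[OF cl(4) cg] continuous_map_snd])+
    fix b assume b: "b \<in> carrier B"
    have "snd (g (\<one>\<^bsub>A'\<^esub>, snd (f (\<one>\<^bsub>A\<^esub>, b)))) = b"
      by (rule quotient_inverse[OF A.is_group B.is_group A'.is_group B'.is_group g _ _ g1]) (use b f_in gf in auto)
    then show "(snd \<circ> (g \<circ> (\<lambda>b. (\<one>\<^bsub>A'\<^esub>, b)))) ((snd \<circ> (f \<circ> (\<lambda>b. (\<one>\<^bsub>A\<^esub>, b)))) b) = b" by simp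
  next
    fix b assume b: "b \<in> carrier B'"
    have "snd (f (\<one>\<^bsub>A\<^esub>, snd (g (\<one>\<^bsub>A'\<^esub>, b)))) = b"
      by (rule quotient_inverse[OF A'.is_group B'.is_group A.is_group B.is_group f _ _ f1]) (use b g_in fg in auto)
    then show "(snd \<circ> (f \<circ> (\<lambda>b. (\<one>\<^bsub>A\<^esub>, b)))) ((snd \<circ> (g \<circ> (\<lambda>b. (\<one>\<^bsub>A'\<^esub>, b)))) b) = b" by simp
  qed
qed

section \<open>Splitting the functions into a product group\<close>

lemma Cp_DirProd_isomorphic:
  fixes G :: "('g, 'm) monoid_scheme" and H :: "('h, 'n) monoid_scheme" and X :: "'x topology"
  assumes G: "topological_group G TG" and H: "topological_group H TH"
  shows "top_group_isomorphic (Cp_grp X (G \<times>\<times> H) (prod_topology TG TH)) (Cp_top X (G \<times>\<times> H) (prod_topology TG TH))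
    (Cp_grp X G TG \<times>\<times> Cp_grp X H TH) (prod_topology (Cp_top X G TG) (Cp_top X H TH))"
proof -
  let ?K = "G \<times>\<times> H" and ?TK = "prod_topology TG TH"
  let ?C = "Cp_grp X ?K ?TK" and ?T = "Cp_top X ?K ?TK"
  let ?D = "Cp_grp X G TG \<times>\<times> Cp_grp X H TH" and ?TD = "prod_topology (Cp_top X G TG) (Cp_top X H TH)"
  define p where "p f = (\<lambda>x\<in>topspace X. fst (f x), \<lambda>x\<in>topspace X. snd (f x))" for f :: "'x \<Rightarrow> 'g \<times> 'h"
  define q where "q z = (\<lambda>x\<in>topspace X. (fst z x, snd z x))" for z :: "('x \<Rightarrow> 'g) \<times> ('x \<Rightarrow> 'h)"
  have p_in: "p f \<in> carrier ?D" if "f \<in> carrier ?C" for f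
  proof -
    have "continuous_map X TG (\<lambda>x. fst (f x))" "continuous_map X TH (\<lambda>x. snd (f x))"
      using that by (simp_all add: carrier_Cp continuous_map_pairwise o_def)
    then show ?thesis by (simp add: p_def restrict_in_Cp)
  qed
  have q_in: "q z \<in> carrier ?C" if "z \<in> carrier ?D" for z
    unfolding q_def using that by (intro restrict_in_Cp continuous_map_pairedI) (auto simp: carrier_Cp)
  have tC: "topological_group ?C ?T" and tD: "topological_group ?D ?TD"
    using G H by (intro topological_group_Cp topological_group_DirProd; simp)+
  show ?thesis
    unfolding top_group_isomorphic_iff[OF tC tD] group_isomorphisms_def
  proof (intro exI[of _ p] exI[of _ q] conjI ballI)
    show "p \<in> hom ?C ?D"
      using p_in by (auto simp: hom_def p_def mult_Cp mult_DirProd' fun_eq_iff)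
    show "q \<in> hom ?D ?C"
      using q_in by (auto simp: hom_def q_def mult_Cp fun_eq_iff)
    show "q (p f) = f" if "f \<in> carrier ?C" for f
      using that by (auto simp: p_def q_def fun_eq_iff carrier_Cp extensional_def)
    show "p (q z) = z" if "z \<in> carrier ?D" for z
      using that by (cases z) (auto simp: p_def q_def fun_eq_iff carrier_Cp extensional_def)
    have ev: "continuous_map ?T TG (\<lambda>f. fst (f x))" "continuous_map ?T TH (\<lambda>f. snd (f x))" if "x \<in> topspace X" for x
      using continuous_map_eval_Cp[OF that, of ?K ?TK] by (simp_all add: continuous_map_pairwise o_def)
    have "continuous_map ?T (Cp_top X G TG) (\<lambda>f. \<lambda>x\<in>topspace X. fst (f x))"
      "continuous_map ?T (Cp_top X H TH) (\<lambda>f. \<lambda>x\<in>topspace X. snd (f x))"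
      unfolding continuous_map_into_Cp_top using ev p_in by (auto simp: topspace_Cp p_def)
    then show "continuous_map ?T ?TD p" unfolding p_def by (intro continuous_map_pairedI)
    have "continuous_map ?TD TG (\<lambda>z. fst z x)" "continuous_map ?TD TH (\<lambda>z. snd z x)" if "x \<in> topspace X" for x
      using continuous_map_compose[OF continuous_map_fst continuous_map_eval_Cp[OF that]]
        continuous_map_compose[OF continuous_map_snd continuous_map_eval_Cp[OF that]] by (simp_all add: o_def)
    then show "continuous_map ?TD ?T q"
      unfolding continuous_map_into_Cp_top using q_in
      by (auto simp: topspace_Cp q_def intro!: continuous_map_pairedI)
  qed
qed

text \<open>The conditions concern \<open>H\<close> and not \<open>C_p(Y,H)\<close>, so the map is
  composed with the evaluation at each \<open>y\<close>; every such composite is a continuous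
  homomorphism into \<open>H\<close>, hence trivial.\<close>

lemma Cp_hom_trivial_second_component:
  assumes G: "topological_group G TG" and H: "topological_group H TH"
    and cond: "(TG closure_of (torsion_part G) = carrier G \<and> torsion_free (completion_grp H TH))
         \<or> (\<exists>n::nat. power_set_grp (completion_grp G TG) n = carrier (completion_grp G TG)
                    \<and> power_set_grp H n = {\<one>\<^bsub>H\<^esub>})"
    and X: "Hausdorff_space X" "Gss_regular X G TG"
    and f: "f \<in> hom (Cp_grp X G TG \<times>\<times> Cp_grp X H TH) (Cp_grp Y G TG \<times>\<times> Cp_grp Y H TH)"
    and cf: "continuous_map (prod_topology (Cp_top X G TG) (Cp_top X H TH)) (prod_topology (Cp_top Y G TG) (Cp_top Y H TH)) f"
    and a: "a \<in> carrier (Cp_grp X G TG)"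
  shows "snd (f (a, \<one>\<^bsub>Cp_grp X H TH\<^esub>)) = \<one>\<^bsub>Cp_grp Y H TH\<^esub>"
proof -
  interpret CX: group "Cp_grp X H TH" by (rule group_Cp[OF H])
  let ?h = "snd \<circ> (f \<circ> (\<lambda>a. (a, \<one>\<^bsub>Cp_grp X H TH\<^esub>)))"
  have inl: "(\<lambda>a. (a, \<one>\<^bsub>Cp_grp X H TH\<^esub>)) \<in> hom (Cp_grp X G TG) (Cp_grp X G TG \<times>\<times> Cp_grp X H TH)"
    by (auto simp: hom_def)
  have snd: "snd \<in> hom (Cp_grp Y G TG \<times>\<times> Cp_grp Y H TH) (Cp_grp Y H TH)" by (auto simp: hom_def)
  have h: "?h \<in> hom (Cp_grp X G TG) (Cp_grp Y H TH)"
    by (rule hom_compose[OF hom_compose[OF inl f] snd])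
  have c_inl: "continuous_map (Cp_top X G TG) (prod_topology (Cp_top X G TG) (Cp_top X H TH)) (\<lambda>a. (a, \<one>\<^bsub>Cp_grp X H TH\<^esub>))"
    by (simp add: continuous_map_paired continuous_map_id[unfolded id_def] topspace_Cp)
  have ch: "continuous_map (Cp_top X G TG) (Cp_top Y H TH) ?h"
    by (rule continuous_map_compose[OF continuous_map_compose[OF c_inl cf] continuous_map_snd])
  have ha: "?h a \<in> carrier (Cp_grp Y H TH)" using hom_in_carrier[OF h a] .
  have "?h a y = \<one>\<^bsub>H\<^esub>" if y: "y \<in> topspace Y" for y
  proof -
    have "(\<lambda>b. b y) \<in> hom (Cp_grp Y H TH) H"
      using y Cp_apply_closed[OF H] by (auto simp: hom_def mult_Cp)
    from hom_compose[OF h this] have "(\<lambda>b. b y) \<circ> ?h \<in> hom (Cp_grp X G TG) H" .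
    moreover have "continuous_map (Cp_top X G TG) TH ((\<lambda>b. b y) \<circ> ?h)"
      by (rule continuous_map_compose[OF ch continuous_map_eval_Cp[OF y]])
    ultimately have "((\<lambda>b. b y) \<circ> ?h) a = \<one>\<^bsub>H\<^esub>" by (rule Cp_hom_trivial[OF G H cond X _ _ a])
    then show ?thesis by simp
  qed
  then have "?h a = \<one>\<^bsub>Cp_grp Y H TH\<^esub>"
    using ha by (auto simp: one_Cp fun_eq_iff carrier_Cp extensional_def)
  then show ?thesis by simp
qed

theorem theorem3p3:
  fixes G :: "'g monoid" and TG :: "'g topology"
    and H :: "'h monoid" and TH :: "'h topology"
    and X :: "'x topology" and Y :: "'y topology"
  assumes "topological_group G TG" and "topological_group H TH"
    and "(TG closure_of (torsion_part G) = carrier G \<and> torsion_free (completion_grp H TH))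
         \<or> (\<exists>n::nat. power_set_grp (completion_grp G TG) n = carrier (completion_grp G TG)
                    \<and> power_set_grp H n = {one H})"
    and "tychonoff_space X" and "tychonoff_space Y"
    and "Gss_regular X G TG" and "Gss_regular Y G TG"
    and "K_equivalent (DirProd G H) (prod_topology TG TH) X Y"
  shows "K_equivalent G TG X Y \<and> K_equivalent H TH X Y"
proof -
  note G = assms(1) and H = assms(2)
  note GH = topological_group_DirProd[OF G H]
  have X: "Hausdorff_space X" and Y: "Hausdorff_space Y"
    using assms(4,5) by (simp_all add: tychonoff_space_def)
  note tX = topological_group_DirProd[OF topological_group_Cp[OF G] topological_group_Cp[OF H], of X X]
    and tY = topological_group_DirProd[OF topological_group_Cp[OF G] topological_group_Cp[OF H], of Y Y]
  have "top_group_isomorphic (Cp_grp X G TG \<times>\<times> Cp_grp X H TH) (prod_topology (Cp_top X G TG) (Cp_top X H TH))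
      (Cp_grp Y G TG \<times>\<times> Cp_grp Y H TH) (prod_topology (Cp_top Y G TG) (Cp_top Y H TH))"
    using top_group_isomorphic_sym[OF topological_group_Cp[OF GH] tX Cp_DirProd_isomorphic[OF G H]]
      assms(8)[unfolded K_equivalent_def] Cp_DirProd_isomorphic[OF G H]
    by (blast intro: top_group_isomorphic_trans)
  then obtain f g where fg: "group_isomorphisms (Cp_grp X G TG \<times>\<times> Cp_grp X H TH) (Cp_grp Y G TG \<times>\<times> Cp_grp Y H TH) f g"
    "continuous_map (prod_topology (Cp_top X G TG) (Cp_top X H TH)) (prod_topology (Cp_top Y G TG) (Cp_top Y H TH)) f"
    "continuous_map (prod_topology (Cp_top Y G TG) (Cp_top Y H TH)) (prod_topology (Cp_top X G TG) (Cp_top X H TH)) g"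
    unfolding top_group_isomorphic_iff[OF tX tY] by blast
  have f: "f \<in> hom (Cp_grp X G TG \<times>\<times> Cp_grp X H TH) (Cp_grp Y G TG \<times>\<times> Cp_grp Y H TH)"
    and g: "g \<in> hom (Cp_grp Y G TG \<times>\<times> Cp_grp Y H TH) (Cp_grp X G TG \<times>\<times> Cp_grp X H TH)"
    using fg(1) by (simp_all add: group_isomorphisms_def)
  show ?thesis
    unfolding K_equivalent_def
    \<comment> \<open>The regularity of \<open>X\<close> makes \<open>f\<close> triangular, that of
      \<open>Y\<close> makes its inverse \<open>g\<close> triangular.\<close>
    using DirProd_isomorphic_factors[OF topological_group_Cp[OF G] topological_group_Cp[OF H]
        topological_group_Cp[OF G] topological_group_Cp[OF H] fg
        Cp_hom_trivial_second_component[OF G H assms(3) X assms(6) f fg(2)]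
        Cp_hom_trivial_second_component[OF G H assms(3) Y assms(7) g fg(3)]]
    by blast
qed

end
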